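(* Let $(E,\|\cdot\|)$ be an $RN$ module with base $(\Omega,\mathcal F,P)$ and $G$ a $\sigma$-stable subset of $E$. Then $G$ is random sequentially compact if and only if it is both random totally bounded and $\mathcal T_{\varepsilon,\lambda}$-complete.
   Context: Notation. $(\Omega,\mathcal F,P)$ is a probability space, $\mathbb K$ is $\mathbb R$ or $\mathbb C$. $L^0(\mathcal F,\mathbb K)$ is the algebra of a.s.-equivalence classes of $\mathbb K$-valued $\mathcal F$-measurable random variables; $L^0(\mathcal F)=L^0(\mathcal F,\mathbb R)$, partially ordered by $\xi\le\eta$ iff $\xi(\omega)\le\eta(\omega)$ a.s.; "$\xi<\eta$ on $\Omega$" means $\xi(\omega)<\eta(\omega)$ a.s. $L^0_+(\mathcal F)=\{\xi\in L^0(\mathcal F):\xi\ge 0\}$, $L^0_{++}(\mathcal F)=\{\xi\in L^0(\mathcal F):\xi>0\text{ on }\Omega\}$. $\tilde I_A$ is the equivalence class of the indicator function $I_A$ of $A\in\mathcal F$; $\tilde I_AG=\{\tilde I_Ag:g\in G\}$. $RN$ module. An $RN$ module $(E,\|\cdot\|)$ over $\mathbb K$ with base $(\Omega,\mathcal F,P)$ is a left module $E$ over the algebra $L^0(\mathcal F,\mathbb K)$ with a map $\|\cdot\|:E\to L^0_+(\mathcal F)$ such that $\|\xi x\|=|\xi|\,\|x\|$ for all $\xi\in L^0(\mathcal F,\mathbb K)$, $x\in E$; $\|x+y\|\le\|x\|+\|y\|$ for all $x,y\in E$; and $\|x\|=0$ implies $x=\theta$ (the null element). Topology. The $(\varepsilon,\lambda)$-topology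 $\mathcal T_{\varepsilon,\lambda}$ on $E$ is the metrizable linear topology with local base at $\theta$ given by the sets $\{x\in E: P\{\omega:\|x\|(\omega)<\varepsilon\}>1-\lambda\}$, $\varepsilon>0$, $0<\lambda<1$; so $x_n\to x$ in $\mathcal T_{\varepsilon,\lambda}$ iff $\|x_n-x\|\to 0$ in probability. $G$ is $\mathcal T_{\varepsilon,\lambda}$-complete if every $\mathcal T_{\varepsilon,\lambda}$-Cauchy sequence in $G$ converges in $\mathcal T_{\varepsilon,\lambda}$ to a point of $G$. $\sigma$-stability. A countable partition of $\Omega$ to $\mathcal F$ is a sequence $\{A_n,n\in\mathbb N\}$ of pairwise disjoint members of $\mathcal F$ with union $\Omega$; $\Pi_{\mathcal F}$ is the set of these. A nonempty $G\subset E$ is $\sigma$-stable if for every sequence $\{x_n\}$ in $G$ and every $\{A_n\}\in\Pi_{\mathcal F}$ there is $x\in G$ with $\tilde I_{A_n}x=\tilde I_{A_n}x_n$ for all $n$; such $x$ is unique and is written $\sum_n\tilde I_{A_n}x_n$. For a nonempty finite set $H=\{x_1,\dots,x_m\}\subset E$, the $\sigma$-stable hull is $\sigma(H)=\{\sum_{k=1}^m\tilde I_{A_k}x_k:\{A_1,\dots,A_m\}\text{ a partition of }\Omega\text{ by members of }\mathcal F\}$. Random sequential compactness. For $\sigma$-stable $G$, a random subsequence of a sequence $\{x_n\}$ in $G$ is a sequence $\{x_{n_k},k\in\mathbb N\}$, $x_{n_k}:=\sum_{l=1}^\infty\tilde I_{(n_k=l)}x_l$, where the $n_k$ are positive-integer-valued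 random variables on $(\Omega,\mathcal F,P)$ with $n_k(\omega)<n_{k+1}(\omega)$ for all $k\in\mathbb N$, $\omega\in\Omega$. $G$ is random sequentially compact if every sequence in $G$ has a random subsequence converging in $\mathcal T_{\varepsilon,\lambda}$ to some element of $G$. Random total boundedness. For $x\in E$, $\varepsilon\in L^0_{++}(\mathcal F)$, $B(x,\varepsilon)=\{y\in E:\|y-x\|<\varepsilon\text{ on }\Omega\}$, and $G_{(\varepsilon)}=\bigcup_{x\in G}B(x,\varepsilon)$ for nonempty $G\subset E$. A nonempty $G\subset E$ is random totally bounded if for every $\varepsilon\in L^0_{++}(\mathcal F)$ there are $\{A_n\}\in\Pi_{\mathcal F}$ and a sequence $\{G_n\}$ of nonempty finite subsets of $G$ such that $\tilde I_{A_n}G\subset\tilde I_{A_n}(\sigma(G_n))_{(\varepsilon)}$ for each $n\in\mathbb N$. *)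

theory Defs
  imports "HOL-Probability.Probability" "HOL-Algebra.Module"
begin

section \<open>The algebra of equivalence classes of random variables\<close>

text \<open>
  The scalar field ranges over \<open>'k :: {real_normed_field, euclidean_space}\<close>. Both \<open>real\<close> and
  \<open>complex\<close> are instances, and by Frobenius' theorem these are, up to isometric isomorphism, the
  only ones: a finite-dimensional field extension of the reals is the reals or the complex
  numbers, and multiplicativity forces the norm to be the usual modulus.
\<close>

definition ae_eq :: "'w measure \<Rightarrow> (('w \<Rightarrow> 'b::topological_space) \<times> ('w \<Rightarrow> 'b)) set" where
  "ae_eq M = {(f, g). f \<in> borel_measurable M \<and> g \<in> borel_measurable M \<and> (AE \<omega> in M. f \<omega> = g \<omega>)}"

abbreviation ae_class :: "'w measure \<Rightarrow> ('w \<Rightarrow> 'b::topological_space) \<Rightarrow> ('w \<Rightarrow> 'b) set" where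
  "ae_class M f \<equiv> ae_eq M `` {f}"

text \<open>
  Operations on classes are computed on chosen representatives; they respect a.s. equality
  (see the lemmas below), so the choice is immaterial.
\<close>

definition rep :: "('w \<Rightarrow> 'b) set \<Rightarrow> 'w \<Rightarrow> 'b" where
  "rep X = (SOME f. f \<in> X)"

definition L0 :: "'w measure \<Rightarrow> ('w \<Rightarrow> 'k::{real_normed_field, euclidean_space}) set ring" where
  "L0 M = \<lparr>carrier = borel_measurable M // ae_eq M,
           monoid.mult = (\<lambda>X Y. ae_class M (\<lambda>\<omega>. rep X \<omega> * rep Y \<omega>)),
           one = ae_class M (\<lambda>_. 1),
           zero = ae_class M (\<lambda>_. 0),
           add = (\<lambda>X Y. ae_class M (\<lambda>\<omega>. rep X \<omega> + rep Y \<omega>))\<rparr>"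

definition L0_abs ::
    "'w measure \<Rightarrow> ('w \<Rightarrow> 'k::{real_normed_field, euclidean_space}) set \<Rightarrow> ('w \<Rightarrow> real) set" where
  "L0_abs M X = ae_class M (\<lambda>\<omega>. norm (rep X \<omega>))"

definition L0_le :: "'w measure \<Rightarrow> ('w \<Rightarrow> real) set \<Rightarrow> ('w \<Rightarrow> real) set \<Rightarrow> bool" where
  "L0_le M X Y \<longleftrightarrow> (AE \<omega> in M. rep X \<omega> \<le> rep Y \<omega>)"

definition L0_less :: "'w measure \<Rightarrow> ('w \<Rightarrow> real) set \<Rightarrow> ('w \<Rightarrow> real) set \<Rightarrow> bool" where
  "L0_less M X Y \<longleftrightarrow> (AE \<omega> in M. rep X \<omega> < rep Y \<omega>)"

definition L0_plus :: "'w measure \<Rightarrow> ('w \<Rightarrow> real) set set" where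
  "L0_plus M = {X \<in> carrier (L0 M). L0_le M \<zero>\<^bsub>L0 M\<^esub> X}"

definition L0_pplus :: "'w measure \<Rightarrow> ('w \<Rightarrow> real) set set" where
  "L0_pplus M = {X \<in> carrier (L0 M). L0_less M \<zero>\<^bsub>L0 M\<^esub> X}"

definition ind_class ::
    "'w measure \<Rightarrow> 'w set \<Rightarrow> ('w \<Rightarrow> 'k::{real_normed_field, euclidean_space}) set" where
  "ind_class M A = ae_class M (indicator A)"

lemma equiv_ae_eq: "equiv (borel_measurable M) (ae_eq M)"
proof (rule equivI)
  show "ae_eq M \<subseteq> borel_measurable M \<times> borel_measurable M"
    by (auto simp: ae_eq_def)
  show "refl_on (borel_measurable M) (ae_eq M)"
    by (auto simp: refl_on_def ae_eq_def)
  show "sym (ae_eq M)"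
    by (auto simp: sym_def ae_eq_def elim: AE_mp)
  show "trans (ae_eq M)"
    by (auto simp: trans_def ae_eq_def)
qed

lemma ae_class_closed: "f \<in> borel_measurable M \<Longrightarrow> ae_class M f \<in> borel_measurable M // ae_eq M"
  by (rule quotientI)

lemma ae_class_eq:
  assumes "f \<in> borel_measurable M" "g \<in> borel_measurable M" "AE \<omega> in M. f \<omega> = g \<omega>"
  shows "ae_class M f = ae_class M g"
  by (rule equiv_class_eq[OF equiv_ae_eq]) (use assms in \<open>auto simp: ae_eq_def\<close>)

lemma ae_class_eqD:
  assumes "f \<in> borel_measurable M" "g \<in> borel_measurable M" "ae_class M f = ae_class M g"
  shows "AE \<omega> in M. f \<omega> = g \<omega>"
  using eq_equiv_class[OF assms(3) equiv_ae_eq assms(2)] by (simp add: ae_eq_def)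

lemma rep_in:
  assumes "X \<in> borel_measurable M // ae_eq M"
  shows "rep X \<in> borel_measurable M" and "ae_class M (rep X) = X"
proof -
  have "X \<noteq> {}" using in_quotient_imp_non_empty[OF equiv_ae_eq assms] .
  then have r: "rep X \<in> X" unfolding rep_def by (simp add: some_in_eq)
  show "rep X \<in> borel_measurable M"
    using in_quotient_imp_subset[OF equiv_ae_eq assms] r by auto
  show "ae_class M (rep X) = X"
    using assms r by (metis Image_singleton_iff equiv_ae_eq equiv_class_eq quotientE)
qed

lemma rep_ae_class:
  assumes "f \<in> borel_measurable M"
  shows "rep (ae_class M f) \<in> borel_measurable M" and "AE \<omega> in M. rep (ae_class M f) \<omega> = f \<omega>"
  using rep_in[OF ae_class_closed[OF assms]] ae_class_eqD[of "rep (ae_class M f)" M f] assms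
  by auto

lemma L0_mult_class:
  fixes f g :: "'w \<Rightarrow> 'k::{real_normed_field, euclidean_space}"
  assumes "f \<in> borel_measurable M" "g \<in> borel_measurable M"
  shows "ae_class M f \<otimes>\<^bsub>L0 M\<^esub> ae_class M g = ae_class M (\<lambda>\<omega>. f \<omega> * g \<omega>)"
proof -
  note [measurable] = assms rep_ae_class(1)[OF assms(1)] rep_ae_class(1)[OF assms(2)]
  show ?thesis
    unfolding L0_def
    by simp (rule ae_class_eq; use rep_ae_class(2)[OF assms(1)] rep_ae_class(2)[OF assms(2)] in auto)
qed

lemma L0_add_class:
  fixes f g :: "'w \<Rightarrow> 'k::{real_normed_field, euclidean_space}"
  assumes "f \<in> borel_measurable M" "g \<in> borel_measurable M"
  shows "ae_class M f \<oplus>\<^bsub>L0 M\<^esub> ae_class M g = ae_class M (\<lambda>\<omega>. f \<omega> + g \<omega>)"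
proof -
  note [measurable] = assms rep_ae_class(1)[OF assms(1)] rep_ae_class(1)[OF assms(2)]
  show ?thesis
    unfolding L0_def
    by simp (rule ae_class_eq; use rep_ae_class(2)[OF assms(1)] rep_ae_class(2)[OF assms(2)] in auto)
qed

lemma L0_abs_class:
  fixes f :: "'w \<Rightarrow> 'k::{real_normed_field, euclidean_space}"
  assumes "f \<in> borel_measurable M"
  shows "L0_abs M (ae_class M f) = ae_class M (\<lambda>\<omega>. norm (f \<omega>))"
proof -
  note [measurable] = assms rep_ae_class(1)[OF assms]
  show ?thesis
    unfolding L0_abs_def by (rule ae_class_eq; use rep_ae_class(2)[OF assms] in auto)
qed

lemma L0_carrierE:
  assumes "X \<in> carrier (L0 M)"
  obtains f where "f \<in> borel_measurable M" "X = ae_class M f"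
  using assms by (auto simp: L0_def elim: quotientE)

lemma L0_zero: "\<zero>\<^bsub>L0 M\<^esub> = ae_class M (\<lambda>_. 0)"
  and L0_one: "\<one>\<^bsub>L0 M\<^esub> = ae_class M (\<lambda>_. 1)"
  by (auto simp: L0_def)

lemma L0_carrierI: "f \<in> borel_measurable M \<Longrightarrow> ae_class M f \<in> carrier (L0 M)"
  by (simp add: L0_def ae_class_closed)

lemma cring_L0: "cring (L0 M :: ('w \<Rightarrow> 'k::{real_normed_field, euclidean_space}) set ring)"
proof (rule cringI)
  show "abelian_group (L0 M :: ('w \<Rightarrow> 'k) set ring)"
  proof (rule abelian_groupI)
    fix X assume "X \<in> carrier (L0 M :: ('w \<Rightarrow> 'k) set ring)"
    then obtain f where f: "f \<in> borel_measurable M" "X = ae_class M f" by (rule L0_carrierE)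
    have "ae_class M (\<lambda>\<omega>. - f \<omega>) \<oplus>\<^bsub>L0 M\<^esub> X = \<zero>\<^bsub>L0 M\<^esub>"
      using f by (simp add: L0_add_class L0_zero)
    then show "\<exists>Y\<in>carrier (L0 M). Y \<oplus>\<^bsub>L0 M\<^esub> X = \<zero>\<^bsub>L0 M\<^esub>"
      using f by (intro bexI) (auto intro!: L0_carrierI)
  qed (auto elim!: L0_carrierE simp: L0_add_class L0_zero add_ac intro!: L0_carrierI)
  show "comm_monoid (L0 M :: ('w \<Rightarrow> 'k) set ring)"
    by (rule comm_monoidI)
      (auto elim!: L0_carrierE simp: L0_mult_class L0_one mult_ac intro!: L0_carrierI)
qed (auto elim!: L0_carrierE simp: L0_mult_class L0_add_class ring_distribs)


section \<open>Random normed modules\<close>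

text \<open>
  As usual in HOL-Algebra, the ring multiplication and unit fields of the record \<open>E\<close> play no role.
\<close>

locale rn_module = prob_space M + Module.module "L0 M" E
  for M :: "'w measure"
    and E :: "(('w \<Rightarrow> 'k::{real_normed_field, euclidean_space}) set, 'e, 'm) module_scheme"
  + fixes nrm :: "'e \<Rightarrow> ('w \<Rightarrow> real) set"
  assumes nrm_closed: "x \<in> carrier E \<Longrightarrow> nrm x \<in> L0_plus M"
    and nrm_smult: "\<lbrakk>\<xi> \<in> carrier (L0 M); x \<in> carrier E\<rbrakk> \<Longrightarrow>
      nrm (\<xi> \<odot>\<^bsub>E\<^esub> x) = L0_abs M \<xi> \<otimes>\<^bsub>L0 M\<^esub> nrm x"
    and nrm_triangle: "\<lbrakk>x \<in> carrier E; y \<in> carrier E\<rbrakk> \<Longrightarrow>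
      L0_le M (nrm (x \<oplus>\<^bsub>E\<^esub> y)) (nrm x \<oplus>\<^bsub>L0 M\<^esub> nrm y)"
    and nrm_definite: "\<lbrakk>x \<in> carrier E; nrm x = \<zero>\<^bsub>L0 M\<^esub>\<rbrakk> \<Longrightarrow> x = \<zero>\<^bsub>E\<^esub>"


section \<open>The (epsilon, lambda)-topology\<close>

definition el_nhd ::
    "'w measure \<Rightarrow> ('s, 'e, 'm) module_scheme \<Rightarrow> ('e \<Rightarrow> ('w \<Rightarrow> real) set) \<Rightarrow> real \<Rightarrow> real \<Rightarrow> 'e set" where
  "el_nhd M E nrm \<epsilon> l =
     {x \<in> carrier E. measure M {\<omega> \<in> space M. rep (nrm x) \<omega> < \<epsilon>} > 1 - l}"

definition el_open ::
    "'w measure \<Rightarrow> ('s, 'e, 'm) module_scheme \<Rightarrow> ('e \<Rightarrow> ('w \<Rightarrow> real) set) \<Rightarrow> 'e set \<Rightarrow> bool" where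
  "el_open M E nrm U \<longleftrightarrow> U \<subseteq> carrier E \<and>
     (\<forall>x\<in>U. \<exists>\<epsilon>>0. \<exists>l>0. l < 1 \<and> {y \<in> carrier E. y \<ominus>\<^bsub>E\<^esub> x \<in> el_nhd M E nrm \<epsilon> l} \<subseteq> U)"

definition el_topology ::
    "'w measure \<Rightarrow> ('s, 'e, 'm) module_scheme \<Rightarrow> ('e \<Rightarrow> ('w \<Rightarrow> real) set) \<Rightarrow> 'e topology" where
  "el_topology M E nrm = topology (el_open M E nrm)"

definition el_Cauchy ::
    "'w measure \<Rightarrow> ('s, 'e, 'm) module_scheme \<Rightarrow> ('e \<Rightarrow> ('w \<Rightarrow> real) set) \<Rightarrow> (nat \<Rightarrow> 'e) \<Rightarrow> bool" where
  "el_Cauchy M E nrm x \<longleftrightarrow>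
     (\<forall>\<epsilon>>0. \<forall>l>0. l < 1 \<longrightarrow> (\<exists>N. \<forall>m\<ge>N. \<forall>n\<ge>N. x m \<ominus>\<^bsub>E\<^esub> x n \<in> el_nhd M E nrm \<epsilon> l))"

definition el_complete ::
    "'w measure \<Rightarrow> ('s, 'e, 'm) module_scheme \<Rightarrow> ('e \<Rightarrow> ('w \<Rightarrow> real) set) \<Rightarrow> 'e set \<Rightarrow> bool" where
  "el_complete M E nrm G \<longleftrightarrow>
     (\<forall>x. range x \<subseteq> G \<and> el_Cauchy M E nrm x \<longrightarrow>
          (\<exists>g\<in>G. limitin (el_topology M E nrm) x g sequentially))"


section \<open>Stability under countable concatenation\<close>

definition countable_partition :: "'w measure \<Rightarrow> (nat \<Rightarrow> 'w set) \<Rightarrow> bool" where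
  "countable_partition M A \<longleftrightarrow>
     range A \<subseteq> sets M \<and> disjoint_family A \<and> (\<Union>n. A n) = space M"

definition sigma_stable ::
    "'w measure \<Rightarrow> (('w \<Rightarrow> 'k::{real_normed_field, euclidean_space}) set, 'e, 'm) module_scheme
      \<Rightarrow> 'e set \<Rightarrow> bool" where
  "sigma_stable M E G \<longleftrightarrow> G \<noteq> {} \<and> G \<subseteq> carrier E \<and>
     (\<forall>x A. range x \<subseteq> G \<and> countable_partition M A \<longrightarrow>
        (\<exists>g\<in>G. \<forall>n. ind_class M (A n) \<odot>\<^bsub>E\<^esub> g = ind_class M (A n) \<odot>\<^bsub>E\<^esub> x n))"

text \<open>
  The element written as the infinite sum of \<open>ind_class M (A n) \<odot> x n\<close>; it is unique
  by \<open>concat_unique\<close> below, and unspecified if it does not exist.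
\<close>

definition concat_seq ::
    "'w measure \<Rightarrow> (('w \<Rightarrow> 'k::{real_normed_field, euclidean_space}) set, 'e, 'm) module_scheme
      \<Rightarrow> (nat \<Rightarrow> 'w set) \<Rightarrow> (nat \<Rightarrow> 'e) \<Rightarrow> 'e" where
  "concat_seq M E A x = (THE y. y \<in> carrier E \<and>
     (\<forall>n. ind_class M (A n) \<odot>\<^bsub>E\<^esub> y = ind_class M (A n) \<odot>\<^bsub>E\<^esub> x n))"

text \<open>
  For finite \<open>H\<close> the partition is indexed by \<open>H\<close> itself; blocks may be empty.
\<close>

definition sigma_hull ::
    "'w measure \<Rightarrow> (('w \<Rightarrow> 'k::{real_normed_field, euclidean_space}) set, 'e, 'm) module_scheme
      \<Rightarrow> 'e set \<Rightarrow> 'e set" where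
  "sigma_hull M E H = {(\<Oplus>\<^bsub>E\<^esub>h\<in>H. ind_class M (A h) \<odot>\<^bsub>E\<^esub> h) | A.
     A ` H \<subseteq> sets M \<and> disjoint_family_on A H \<and> (\<Union>h\<in>H. A h) = space M}"


section \<open>Random sequential compactness and random total boundedness\<close>

text \<open>
  Sequences are indexed from 0, so the random indices take values in all of \<open>nat\<close>.
\<close>

definition random_indices :: "'w measure \<Rightarrow> (nat \<Rightarrow> 'w \<Rightarrow> nat) \<Rightarrow> bool" where
  "random_indices M n \<longleftrightarrow>
     (\<forall>k. n k \<in> measurable M (count_space UNIV)) \<and> (\<forall>k. \<forall>\<omega>\<in>space M. n k \<omega> < n (Suc k) \<omega>)"

definition random_subseq ::
    "'w measure \<Rightarrow> (('w \<Rightarrow> 'k::{real_normed_field, euclidean_space}) set, 'e, 'm) module_scheme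
      \<Rightarrow> (nat \<Rightarrow> 'e) \<Rightarrow> (nat \<Rightarrow> 'w \<Rightarrow> nat) \<Rightarrow> nat \<Rightarrow> 'e" where
  "random_subseq M E x n k = concat_seq M E (\<lambda>l. {\<omega> \<in> space M. n k \<omega> = l}) x"

definition random_seq_compact ::
    "'w measure \<Rightarrow> (('w \<Rightarrow> 'k::{real_normed_field, euclidean_space}) set, 'e, 'm) module_scheme
      \<Rightarrow> ('e \<Rightarrow> ('w \<Rightarrow> real) set) \<Rightarrow> 'e set \<Rightarrow> bool" where
  "random_seq_compact M E nrm G \<longleftrightarrow>
     (\<forall>x. range x \<subseteq> G \<longrightarrow> (\<exists>n. random_indices M n \<and>
        (\<exists>g\<in>G. limitin (el_topology M E nrm) (random_subseq M E x n) g sequentially)))"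

definition rn_ball ::
    "'w measure \<Rightarrow> ('s, 'e, 'm) module_scheme \<Rightarrow> ('e \<Rightarrow> ('w \<Rightarrow> real) set)
      \<Rightarrow> 'e \<Rightarrow> ('w \<Rightarrow> real) set \<Rightarrow> 'e set" where
  "rn_ball M E nrm x \<epsilon> = {y \<in> carrier E. L0_less M (nrm (y \<ominus>\<^bsub>E\<^esub> x)) \<epsilon>}"

definition rn_enlarge ::
    "'w measure \<Rightarrow> ('s, 'e, 'm) module_scheme \<Rightarrow> ('e \<Rightarrow> ('w \<Rightarrow> real) set)
      \<Rightarrow> 'e set \<Rightarrow> ('w \<Rightarrow> real) set \<Rightarrow> 'e set" where
  "rn_enlarge M E nrm G \<epsilon> = (\<Union>x\<in>G. rn_ball M E nrm x \<epsilon>)"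

definition ind_image ::
    "'w measure \<Rightarrow> (('w \<Rightarrow> 'k::{real_normed_field, euclidean_space}) set, 'e, 'm) module_scheme
      \<Rightarrow> 'w set \<Rightarrow> 'e set \<Rightarrow> 'e set" where
  "ind_image M E A G = (\<lambda>g. ind_class M A \<odot>\<^bsub>E\<^esub> g) ` G"

definition random_totally_bounded ::
    "'w measure \<Rightarrow> (('w \<Rightarrow> 'k::{real_normed_field, euclidean_space}) set, 'e, 'm) module_scheme
      \<Rightarrow> ('e \<Rightarrow> ('w \<Rightarrow> real) set) \<Rightarrow> 'e set \<Rightarrow> bool" where
  "random_totally_bounded M E nrm G \<longleftrightarrow> G \<noteq> {} \<and> G \<subseteq> carrier E \<and>
     (\<forall>\<epsilon>\<in>L0_pplus M. \<exists>A Gs. countable_partition M A \<and>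
        (\<forall>n. finite (Gs n) \<and> Gs n \<noteq> {} \<and> Gs n \<subseteq> G \<and>
           ind_image M E (A n) G \<subseteq>
           ind_image M E (A n) (rn_enlarge M E nrm (sigma_hull M E (Gs n)) \<epsilon>)))"


section \<open>The definitions are meaningful\<close>

lemma el_nhd_mono:
  fixes M :: "'w measure"
  assumes "rn_module M E nrm" "\<epsilon> \<le> \<epsilon>'" "l \<le> l'"
  shows "el_nhd M E nrm \<epsilon> l \<subseteq> el_nhd M E nrm \<epsilon>' l'"
proof
  interpret rn_module M E nrm by fact
  fix x assume x: "x \<in> el_nhd M E nrm \<epsilon> l"
  then have c: "x \<in> carrier E" by (simp add: el_nhd_def)
  have "nrm x \<in> borel_measurable M // ae_eq M"
    using nrm_closed[OF c] by (auto simp: L0_plus_def L0_def)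
  then have [measurable]: "rep (nrm x) \<in> borel_measurable M" by (rule rep_in)
  have "measure M {\<omega> \<in> space M. rep (nrm x) \<omega> < \<epsilon>} \<le> measure M {\<omega> \<in> space M. rep (nrm x) \<omega> < \<epsilon>'}"
    by (rule finite_measure_mono) (use assms in auto)
  then show "x \<in> el_nhd M E nrm \<epsilon>' l'"
    using x assms by (auto simp: el_nhd_def)
qed

lemma istopology_el_open:
  assumes "rn_module M E nrm"
  shows "istopology (el_open M E nrm)"
  unfolding istopology_def
proof (intro conjI allI impI)
  fix S T assume S: "el_open M E nrm S" and T: "el_open M E nrm T"
  show "el_open M E nrm (S \<inter> T)"
    unfolding el_open_def
  proof (intro conjI ballI)
    show "S \<inter> T \<subseteq> carrier E" using S by (auto simp: el_open_def)
    fix x assume x: "x \<in> S \<inter> T"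
    obtain e1 l1 where 1: "e1 > 0" "l1 > 0" "l1 < 1"
      "{y \<in> carrier E. y \<ominus>\<^bsub>E\<^esub> x \<in> el_nhd M E nrm e1 l1} \<subseteq> S"
      using S x unfolding el_open_def by blast
    obtain e2 l2 where 2: "e2 > 0" "l2 > 0" "l2 < 1"
      "{y \<in> carrier E. y \<ominus>\<^bsub>E\<^esub> x \<in> el_nhd M E nrm e2 l2} \<subseteq> T"
      using T x unfolding el_open_def by blast
    have "{y \<in> carrier E. y \<ominus>\<^bsub>E\<^esub> x \<in> el_nhd M E nrm (min e1 e2) (min l1 l2)} \<subseteq> S \<inter> T"
      using 1(4) 2(4) el_nhd_mono[OF assms, of "min e1 e2" e1 "min l1 l2" l1]
        el_nhd_mono[OF assms, of "min e1 e2" e2 "min l1 l2" l2] by auto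
    then show "\<exists>\<epsilon>>0. \<exists>l>0. l < 1 \<and>
        {y \<in> carrier E. y \<ominus>\<^bsub>E\<^esub> x \<in> el_nhd M E nrm \<epsilon> l} \<subseteq> S \<inter> T"
      using 1 2 by (intro exI[of _ "min e1 e2"] conjI exI[of _ "min l1 l2"]) auto
  qed
next
  fix \<K> assume "\<forall>K\<in>\<K>. el_open M E nrm K"
  then show "el_open M E nrm (\<Union>\<K>)"
    unfolding el_open_def by (meson Sup_least UnionE Union_upper subset_trans)
qed

lemma (in rn_module) openin_el_topology: "openin (el_topology M E nrm) U \<longleftrightarrow> el_open M E nrm U"
  unfolding el_topology_def
  using istopology_el_open[OF rn_module_axioms] by simp

lemma (in rn_module) nrm_zero: "nrm \<zero>\<^bsub>E\<^esub> = \<zero>\<^bsub>L0 M\<^esub>"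
proof -
  interpret LR: cring "L0 M :: ('w \<Rightarrow> real) set ring" by (rule cring_L0)
  interpret LK: cring "L0 M :: ('w \<Rightarrow> 'k) set ring" by (rule cring_L0)
  have "nrm (\<zero>\<^bsub>L0 M\<^esub> \<odot>\<^bsub>E\<^esub> \<zero>\<^bsub>E\<^esub>) =
      L0_abs M (\<zero>\<^bsub>L0 M\<^esub> :: ('w \<Rightarrow> 'k) set) \<otimes>\<^bsub>L0 M\<^esub> nrm \<zero>\<^bsub>E\<^esub>"
    by (rule nrm_smult) auto
  also have "L0_abs M (\<zero>\<^bsub>L0 M\<^esub> :: ('w \<Rightarrow> 'k) set) = \<zero>\<^bsub>L0 M\<^esub>"
    by (simp add: L0_zero L0_abs_class)
  finally show ?thesis
    using nrm_closed[of "\<zero>\<^bsub>E\<^esub>"] by (simp add: L0_plus_def)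
qed

lemma (in rn_module) concat_unique:
  assumes A: "countable_partition M A" and x: "x \<in> carrier E" and y: "y \<in> carrier E"
    and eq: "\<And>n. ind_class M (A n) \<odot>\<^bsub>E\<^esub> x = ind_class M (A n) \<odot>\<^bsub>E\<^esub> y"
  shows "x = y"
proof -
  let ?d = "x \<ominus>\<^bsub>E\<^esub> y"
  have d: "?d \<in> carrier E" using x y by simp
  have "nrm ?d \<in> carrier (L0 M)" using nrm_closed[OF d] by (simp add: L0_plus_def)
  then obtain f where f: "f \<in> borel_measurable M" "nrm ?d = ae_class M f" by (rule L0_carrierE)
  have "AE \<omega> in M. indicator (A n) \<omega> * f \<omega> = 0" for n
  proof -
    have An: "A n \<in> sets M" using A by (auto simp: countable_partition_def)
    then have I: "(indicator (A n) :: 'w \<Rightarrow> 'k) \<in> borel_measurable M" by simp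
    then have Ic: "(ind_class M (A n) :: ('w \<Rightarrow> 'k) set) \<in> carrier (L0 M)"
      unfolding ind_class_def by (rule L0_carrierI)
    have "ind_class M (A n) \<odot>\<^bsub>E\<^esub> ?d = \<zero>\<^bsub>E\<^esub>"
      using Ic x y eq[of n]
      by (simp add: M.minus_eq smult_r_distr smult_r_minus M.r_neg)
    then have "\<zero>\<^bsub>L0 M\<^esub> = L0_abs M (ind_class M (A n) :: ('w \<Rightarrow> 'k) set) \<otimes>\<^bsub>L0 M\<^esub> nrm ?d"
      using nrm_smult[OF Ic d] nrm_zero by simp
    also have "\<dots> = ae_class M (\<lambda>\<omega>. norm (indicator (A n) \<omega> :: 'k) * f \<omega>)"
      using An f by (simp add: ind_class_def L0_abs_class L0_mult_class)
    finally have "AE \<omega> in M. 0 = norm (indicator (A n) \<omega> :: 'k) * f \<omega>"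
      unfolding L0_zero using An f by (intro ae_class_eqD) auto
    then show ?thesis by eventually_elim (auto split: split_indicator)
  qed
  then have "AE \<omega> in M. \<forall>n. indicator (A n) \<omega> * f \<omega> = 0" by (subst AE_all_countable) blast
  then have "AE \<omega> in M. f \<omega> = 0"
    using AE_space
  proof eventually_elim
    case (elim \<omega>)
    from elim(2) A obtain n where "\<omega> \<in> A n" by (auto simp: countable_partition_def)
    then show ?case using elim(1) by (auto dest: spec[of _ n])
  qed
  then have "nrm ?d = \<zero>\<^bsub>L0 M\<^esub>"
    unfolding f(2) L0_zero using f(1) by (intro ae_class_eq) auto
  then have "?d = \<zero>\<^bsub>E\<^esub>" using d nrm_definite by blast
  then show ?thesis using x y by (metis M.add.inv_closed M.add.inv_equality M.minus_eq M.minus_minus)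
qed

end

theory Submission
  imports Defs
begin

text \<open>
  The random norm gives a random pseudometric \<open>rdist x y \<omega>\<close>, and concatenation means choosing,
  measurably in \<open>\<omega>\<close>, one member of a sequence.

  If \<open>G\<close> is random totally bounded, then for almost every \<open>\<omega>\<close> a given sequence in \<open>G\<close> is totally
  bounded for \<open>rdist _ _ \<omega>\<close>. The classical extraction of a Cauchy subsequence always takes the
  least admissible index, hence depends measurably on \<open>\<omega>\<close>, and yields a random subsequence that
  is almost surely Cauchy.

  Conversely, a Cauchy sequence has a subsequence with summable steps; a random subsequence of the
  latter is uniformly close to it outside a small event, so both have the same limit. For random
  total boundedness, choose greedily \<open>x n \<in> G\<close> such that the event that \<open>x n\<close> is \<open>\<epsilon>\<close>-far from all
  previous points is maximal. On the intersection of these events no random subsequence can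
  converge, so it is null; off the \<open>n\<close>-th event every element of \<open>G\<close> is, by maximality,
  \<open>\<epsilon>\<close>-close to one of \<open>x 0, \<dots>, x (n - 1)\<close>.
\<close>

section \<open>Extraction of a Cauchy subsequence at a fixed sample point, and its
  measurability\<close>

lemma geometric_chain:
  fixes D :: "nat \<Rightarrow> nat \<Rightarrow> real"
  assumes "D N N \<le> 0" "\<And>i j k. D i k \<le> D i j + D j k"
    and "\<And>j. N \<le> j \<Longrightarrow> D j (Suc j) < (1/2)^j" and "N \<le> m"
  shows "D N m \<le> 2 * (1/2)^N - 2 * (1/2)^m"
  using \<open>N \<le> m\<close>
proof (induction m rule: dec_induct)
  case base
  then show ?case using assms(1) by simp
next
  \<comment> \<open>The bound is the exact value of the sum of \<open>(1/2)^j\<close> over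
    \<open>N \<le> j < m\<close>, so adding the term for \<open>m\<close> preserves it. The
    subtracted tail later yields strict inequalities.\<close>
  case (step m)
  then show ?case using assms(2)[of N "Suc m" m] assms(3)[of m] by simp
qed

text \<open>Pigeonhole: one of the finitely many centres lies within \<open>e / 2\<close> of
  infinitely many points with index in \<open>S\<close>, and any two of those are within
  \<open>e\<close>. Symmetry of the distance is built into \<open>tri\<close>.\<close>

lemma infinite_close_pairs:
  fixes D :: "'a \<Rightarrow> 'a \<Rightarrow> real" and x :: "nat \<Rightarrow> 'a"
  assumes K: "finite K" and cov: "\<And>i. \<exists>h\<in>K. D (x i) h < e / 2"
    and tri: "\<And>i m h. h \<in> K \<Longrightarrow> D (x i) (x m) \<le> D (x i) h + D (x m) h"
    and S: "infinite S"
  shows "\<exists>i\<in>S. infinite {m\<in>S. i < m \<and> D (x i) (x m) < e}"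
proof -
  have "S \<subseteq> (\<Union>h\<in>K. {i\<in>S. D (x i) h < e / 2})" using cov by auto
  then have "infinite (\<Union>h\<in>K. {i\<in>S. D (x i) h < e / 2})" using S finite_subset by blast
  then obtain h where h: "h \<in> K" and inf: "infinite {i\<in>S. D (x i) h < e / 2}"
    using K by blast
  then obtain i where i: "i \<in> S" "D (x i) h < e / 2"
    by (metis (mono_tags, lifting) Collect_empty_eq finite.emptyI)
  have "infinite ({i\<in>S. D (x i) h < e / 2} - {..i})" using inf by simp
  moreover have "{i\<in>S. D (x i) h < e / 2} - {..i} \<subseteq> {m\<in>S. i < m \<and> D (x i) (x m) < e}"
  proof
    fix m assume "m \<in> {i\<in>S. D (x i) h < e / 2} - {..i}"
    then have m: "m \<in> S" "i < m" "D (x m) h < e / 2" by auto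
    show "m \<in> {m\<in>S. i < m \<and> D (x i) (x m) < e}"
      using tri[OF h, of i m] i(2) m by simp
  qed
  ultimately show ?thesis using i finite_subset by blast
qed

text \<open>
  The \<open>(k+1)\<close>-st set keeps those members of the \<open>k\<close>-th that are within \<open>1/2^k\<close> of \<open>i\<close>, the least
  member for which infinitely many survive; this \<open>i\<close> is \<open>nested_index D k \<omega>\<close>.
\<close>
primrec nested_index_sets :: "(nat \<Rightarrow> nat \<Rightarrow> 'w \<Rightarrow> real) \<Rightarrow> nat \<Rightarrow> 'w \<Rightarrow> nat set" where
  "nested_index_sets D 0 \<omega> = UNIV"
| "nested_index_sets D (Suc k) \<omega> =
    (let i = LEAST i. i \<in> nested_index_sets D k \<omega> \<and>
        (\<forall>N. \<exists>m>N. m \<in> nested_index_sets D k \<omega> \<and> i < m \<and> D i m \<omega> < (1/2)^k)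
     in {m \<in> nested_index_sets D k \<omega>. i < m \<and> D i m \<omega> < (1/2)^k})"

definition nested_index :: "(nat \<Rightarrow> nat \<Rightarrow> 'w \<Rightarrow> real) \<Rightarrow> nat \<Rightarrow> 'w \<Rightarrow> nat" where
  "nested_index D k \<omega> = (LEAST i. i \<in> nested_index_sets D k \<omega> \<and>
     (\<forall>N. \<exists>m>N. m \<in> nested_index_sets D k \<omega> \<and> i < m \<and> D i m \<omega> < (1/2)^k))"

text \<open>Induction on the level: measurable membership in the \<open>k\<close>-th set makes the
  least index measurable, and that index defines the next set. Infinitude is written as
  unboundedness so that only countable quantifiers occur, and a distance at a random index is a
  countable patchwork of measurable functions.\<close>

lemma measurable_nested_index:
  assumes [measurable]: "\<And>i m. D i m \<in> borel_measurable M"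
  shows "nested_index D k \<in> measurable M (count_space UNIV)"
proof -
  have step: "nested_index D k \<in> measurable M (count_space UNIV)"
    if [measurable]: "\<And>m. Measurable.pred M (\<lambda>\<omega>. m \<in> nested_index_sets D k \<omega>)" for k
    unfolding nested_index_def by measurable
  have "Measurable.pred M (\<lambda>\<omega>. m \<in> nested_index_sets D k \<omega>)" for m
  proof (induction k arbitrary: m)
    case (Suc k)
    note [measurable] = Suc step[OF Suc]
    have [measurable]: "(\<lambda>\<omega>. D (nested_index D k \<omega>) m \<omega>) \<in> borel_measurable M"
      by (rule measurable_compose_countable[where f = "\<lambda>i. D i m"]) measurable
    show ?case
      unfolding nested_index_sets.simps Let_def nested_index_def[symmetric] by simp
  qed simp
  then show ?thesis by (rule step)
qed

text \<open>The hypothesis keeps the recursion alive: from an infinite set the \<open>LEAST\<close>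
  is attained and leaves an infinite set behind. The next index belongs to this remaining set, whose
  defining conditions are the two conclusions.\<close>

lemma nested_index_props:
  assumes D: "\<And>k S. infinite S \<Longrightarrow> \<exists>i\<in>S. infinite {m\<in>S. i < m \<and> D i m \<omega> < (1/2)^k}"
  shows "nested_index D k \<omega> < nested_index D (Suc k) \<omega>"
    and "D (nested_index D k \<omega>) (nested_index D (Suc k) \<omega>) \<omega> < (1/2)^k"
proof -
  let ?S = "\<lambda>k. nested_index_sets D k \<omega>"
  have Suc: "?S (Suc k) =
      {m \<in> ?S k. nested_index D k \<omega> < m \<and> D (nested_index D k \<omega>) m \<omega> < (1/2)^k}" for k
    unfolding nested_index_sets.simps Let_def nested_index_def[symmetric] by simp
  have least: "nested_index D k \<omega> \<in> ?S k \<and> infinite (?S (Suc k))" if inf: "infinite (?S k)" for k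
  proof -
    let ?P = "\<lambda>i. i \<in> ?S k \<and> (\<forall>N. \<exists>m>N. m \<in> ?S k \<and> i < m \<and> D i m \<omega> < (1/2)^k)"
    obtain i where "i \<in> ?S k" "infinite {m \<in> ?S k. i < m \<and> D i m \<omega> < (1/2)^k}"
      using D[OF inf, of k] by blast
    then have "?P i" by (simp add: infinite_nat_iff_unbounded)
    then have "?P (nested_index D k \<omega>)" unfolding nested_index_def by (rule LeastI)
    then show ?thesis unfolding Suc by (simp add: infinite_nat_iff_unbounded)
  qed
  have "infinite (?S k)" for k
    by (induction k) (use least in auto)
  then have "nested_index D (Suc k) \<omega> \<in> ?S (Suc k)" using least by blast
  then show "nested_index D k \<omega> < nested_index D (Suc k) \<omega>"
    and "D (nested_index D k \<omega>) (nested_index D (Suc k) \<omega>) \<omega> < (1/2)^k"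
    unfolding Suc by auto
qed

section \<open>The random norm on representatives, almost surely\<close>

context rn_module
begin

lemma nrm_carrier: "x \<in> carrier E \<Longrightarrow> nrm x \<in> borel_measurable M // ae_eq M"
  using nrm_closed by (auto simp: L0_plus_def L0_def)

lemma measurable_rep_nrm: "x \<in> carrier E \<Longrightarrow> rep (nrm x) \<in> borel_measurable M"
  using nrm_carrier by (rule rep_in)

lemma AE_rep_nrm_nonneg:
  assumes "x \<in> carrier E"
  shows "AE \<omega> in M. 0 \<le> rep (nrm x) \<omega>"
proof -
  have "AE \<omega> in M. rep (\<zero>\<^bsub>L0 M\<^esub>) \<omega> \<le> rep (nrm x) \<omega>"
    using nrm_closed[OF assms] by (simp add: L0_plus_def L0_le_def)
  moreover have "AE \<omega> in M. rep (\<zero>\<^bsub>L0 M\<^esub>) \<omega> = (0::real)"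
    unfolding L0_zero by (rule rep_ae_class) simp
  ultimately show ?thesis by eventually_elim simp
qed

lemma AE_rep_nrm_smult:
  assumes [measurable]: "f \<in> borel_measurable M" and x: "x \<in> carrier E"
  shows "AE \<omega> in M. rep (nrm (ae_class M f \<odot>\<^bsub>E\<^esub> x)) \<omega> = norm (f \<omega>) * rep (nrm x) \<omega>"
proof -
  note [measurable] = measurable_rep_nrm[OF x]
  have "nrm (ae_class M f \<odot>\<^bsub>E\<^esub> x) =
      ae_class M (\<lambda>\<omega>. norm (f \<omega>)) \<otimes>\<^bsub>L0 M\<^esub> ae_class M (rep (nrm x))"
    using x rep_in(2)[OF nrm_carrier[OF x]]
    by (simp add: nrm_smult L0_carrierI L0_abs_class)
  also have "\<dots> = ae_class M (\<lambda>\<omega>. norm (f \<omega>) * rep (nrm x) \<omega>)"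
    by (rule L0_mult_class) measurable
  finally show ?thesis by (simp add: rep_ae_class(2))
qed

lemma AE_rep_nrm_triangle:
  assumes x: "x \<in> carrier E" and y: "y \<in> carrier E"
  shows "AE \<omega> in M. rep (nrm (x \<oplus>\<^bsub>E\<^esub> y)) \<omega> \<le> rep (nrm x) \<omega> + rep (nrm y) \<omega>"
proof -
  note [measurable] = x[THEN measurable_rep_nrm] y[THEN measurable_rep_nrm]
  have "nrm x \<oplus>\<^bsub>L0 M\<^esub> nrm y = ae_class M (\<lambda>\<omega>. rep (nrm x) \<omega> + rep (nrm y) \<omega>)"
    using L0_add_class[of "rep (nrm x)" M "rep (nrm y)"] x y
    by (simp add: rep_in(2) nrm_carrier)
  then have "AE \<omega> in M. rep (nrm x \<oplus>\<^bsub>L0 M\<^esub> nrm y) \<omega> = rep (nrm x) \<omega> + rep (nrm y) \<omega>"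
    by (simp add: rep_ae_class(2))
  moreover have "AE \<omega> in M. rep (nrm (x \<oplus>\<^bsub>E\<^esub> y)) \<omega> \<le> rep (nrm x \<oplus>\<^bsub>L0 M\<^esub> nrm y) \<omega>"
    using nrm_triangle[OF x y] by (simp add: L0_le_def)
  ultimately show ?thesis by eventually_elim simp
qed

lemma AE_rep_nrm_zero: "AE \<omega> in M. rep (nrm \<zero>\<^bsub>E\<^esub>) \<omega> = 0"
  unfolding nrm_zero L0_zero by (rule rep_ae_class) simp

lemma rep_nrm_definite:
  assumes "x \<in> carrier E" "AE \<omega> in M. rep (nrm x) \<omega> = 0"
  shows "x = \<zero>\<^bsub>E\<^esub>"
proof -
  have "nrm x = ae_class M (rep (nrm x))" using nrm_carrier[OF assms(1)] rep_in(2) by auto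
  also have "\<dots> = \<zero>\<^bsub>L0 M\<^esub>"
    unfolding L0_zero using assms measurable_rep_nrm by (intro ae_class_eq) auto
  finally show ?thesis using assms nrm_definite by blast
qed

text \<open>Negation is multiplication by the class of the constant \<open>-1\<close>, whose modulus
  is one.\<close>

lemma AE_rep_nrm_minus:
  assumes x: "x \<in> carrier E"
  shows "AE \<omega> in M. rep (nrm (\<ominus>\<^bsub>E\<^esub> x)) \<omega> = rep (nrm x) \<omega>"
proof -
  let ?c = "ae_class M (\<lambda>_. -1) :: ('w \<Rightarrow> 'k) set"
  have c: "?c \<in> carrier (L0 M)" by (simp add: L0_carrierI)
  have "?c \<odot>\<^bsub>E\<^esub> x \<oplus>\<^bsub>E\<^esub> x = (?c \<oplus>\<^bsub>L0 M\<^esub> \<one>\<^bsub>L0 M\<^esub>) \<odot>\<^bsub>E\<^esub> x"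
    using c x by (simp add: smult_l_distr)
  also have "?c \<oplus>\<^bsub>L0 M\<^esub> \<one>\<^bsub>L0 M\<^esub> = \<zero>\<^bsub>L0 M\<^esub>"
    by (simp add: L0_one L0_zero L0_add_class)
  finally have "?c \<odot>\<^bsub>E\<^esub> x \<oplus>\<^bsub>E\<^esub> x = \<zero>\<^bsub>E\<^esub>" using x by simp
  then have "?c \<odot>\<^bsub>E\<^esub> x = \<ominus>\<^bsub>E\<^esub> x" using c x by (simp add: M.minus_equality)
  then show ?thesis using AE_rep_nrm_smult[of "\<lambda>_. -1" x] x by simp
qed

section \<open>The random pseudometric\<close>

definition rdist :: "'e \<Rightarrow> 'e \<Rightarrow> 'w \<Rightarrow> real" where
  "rdist x y = rep (nrm (x \<ominus>\<^bsub>E\<^esub> y))"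

lemma measurable_rdist: "x \<in> carrier E \<Longrightarrow> y \<in> carrier E \<Longrightarrow> rdist x y \<in> borel_measurable M"
  by (simp add: rdist_def measurable_rep_nrm)

lemma AE_rdist_nonneg: "x \<in> carrier E \<Longrightarrow> y \<in> carrier E \<Longrightarrow> AE \<omega> in M. 0 \<le> rdist x y \<omega>"
  by (simp add: rdist_def AE_rep_nrm_nonneg)

lemma AE_rdist_self: "x \<in> carrier E \<Longrightarrow> AE \<omega> in M. rdist x x \<omega> = 0"
  using AE_rep_nrm_zero by (simp add: rdist_def M.minus_eq M.r_neg)

lemma AE_rdist_commute:
  assumes "x \<in> carrier E" "y \<in> carrier E"
  shows "AE \<omega> in M. rdist x y \<omega> = rdist y x \<omega>"
proof -
  have "x \<ominus>\<^bsub>E\<^esub> y = \<ominus>\<^bsub>E\<^esub> (y \<ominus>\<^bsub>E\<^esub> x)"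
    using assms by (simp add: M.minus_eq M.minus_add M.a_comm)
  then show ?thesis using assms by (simp add: rdist_def AE_rep_nrm_minus)
qed

lemma AE_rdist_triangle:
  assumes "x \<in> carrier E" "y \<in> carrier E" "z \<in> carrier E"
  shows "AE \<omega> in M. rdist x z \<omega> \<le> rdist x y \<omega> + rdist y z \<omega>"
proof -
  have "x \<ominus>\<^bsub>E\<^esub> z = (x \<ominus>\<^bsub>E\<^esub> y) \<oplus>\<^bsub>E\<^esub> (y \<ominus>\<^bsub>E\<^esub> z)"
    using assms by (simp add: M.minus_eq M.a_assoc M.r_neg2 M.r_neg1)
  then show ?thesis
    using AE_rep_nrm_triangle[of "x \<ominus>\<^bsub>E\<^esub> y" "y \<ominus>\<^bsub>E\<^esub> z"] assms by (simp add: rdist_def)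
qed

text \<open>Each law has its own null set for each choice of points. A sequence involves only
  countably many choices, so one null set serves all, and later arguments can fix
  \<open>\<omega>\<close> and use indices that depend on it.\<close>

lemma AE_rdist_pseudometric:
  fixes x :: "nat \<Rightarrow> 'e"
  assumes "\<And>i. x i \<in> carrier E"
  shows "AE \<omega> in M. \<forall>i j k. rdist (x i) (x i) \<omega> = 0 \<and> 0 \<le> rdist (x i) (x j) \<omega> \<and>
    rdist (x i) (x j) \<omega> = rdist (x j) (x i) \<omega> \<and>
    rdist (x i) (x k) \<omega> \<le> rdist (x i) (x j) \<omega> + rdist (x j) (x k) \<omega>"
  using assms
  by (simp add: AE_all_countable AE_rdist_self AE_rdist_nonneg AE_rdist_commute AE_rdist_triangle)

lemma rdist_definite:
  assumes "x \<in> carrier E" "y \<in> carrier E" "AE \<omega> in M. rdist x y \<omega> = 0"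
  shows "x = y"
proof -
  have "x \<ominus>\<^bsub>E\<^esub> y = \<zero>\<^bsub>E\<^esub>"
    using assms rep_nrm_definite[of "x \<ominus>\<^bsub>E\<^esub> y"] by (simp add: rdist_def)
  then show ?thesis
    using assms by (metis M.add.inv_closed M.add.inv_equality M.minus_eq M.minus_minus)
qed

lemma ind_class_carrier: "A \<in> sets M \<Longrightarrow> (ind_class M A :: ('w \<Rightarrow> 'k) set) \<in> carrier (L0 M)"
  by (simp add: ind_class_def L0_carrierI)

text \<open>By homogeneity of the random norm, the difference of \<open>x\<close> and
  \<open>y\<close> cut down to \<open>A\<close> has norm \<open>indicator A * rdist x y\<close>.
  This turns algebraic agreement on \<open>A\<close> into a pointwise statement.\<close>

lemma ind_smult_eq_iff:
  assumes A: "A \<in> sets M" and x: "x \<in> carrier E" and y: "y \<in> carrier E"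
  shows "ind_class M A \<odot>\<^bsub>E\<^esub> x = ind_class M A \<odot>\<^bsub>E\<^esub> y \<longleftrightarrow>
    (AE \<omega> in M. \<omega> \<in> A \<longrightarrow> rdist x y \<omega> = 0)"
proof -
  note Ac = ind_class_carrier[OF A]
  have eq: "ind_class M A \<odot>\<^bsub>E\<^esub> (x \<ominus>\<^bsub>E\<^esub> y) =
      ind_class M A \<odot>\<^bsub>E\<^esub> x \<ominus>\<^bsub>E\<^esub> ind_class M A \<odot>\<^bsub>E\<^esub> y"
    using Ac x y by (simp add: M.minus_eq smult_r_distr smult_r_minus)
  have ae: "AE \<omega> in M. rdist (ind_class M A \<odot>\<^bsub>E\<^esub> x) (ind_class M A \<odot>\<^bsub>E\<^esub> y) \<omega>
      = norm (indicator A \<omega> :: 'k) * rdist x y \<omega>"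
    using AE_rep_nrm_smult[of "indicator A :: 'w \<Rightarrow> 'k" "x \<ominus>\<^bsub>E\<^esub> y"] A x y
    unfolding rdist_def eq[symmetric] ind_class_def[symmetric] by simp
  show ?thesis
  proof
    assume e: "ind_class M A \<odot>\<^bsub>E\<^esub> x = ind_class M A \<odot>\<^bsub>E\<^esub> y"
    show "AE \<omega> in M. \<omega> \<in> A \<longrightarrow> rdist x y \<omega> = 0"
      using ae AE_rdist_self[of "ind_class M A \<odot>\<^bsub>E\<^esub> y"] Ac y unfolding e
      by (auto split: split_indicator_asm)
  next
    assume "AE \<omega> in M. \<omega> \<in> A \<longrightarrow> rdist x y \<omega> = 0"
    with ae have "AE \<omega> in M. rdist (ind_class M A \<odot>\<^bsub>E\<^esub> x) (ind_class M A \<odot>\<^bsub>E\<^esub> y) \<omega> = 0"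
      by eventually_elim (auto split: split_indicator)
    then show "ind_class M A \<odot>\<^bsub>E\<^esub> x = ind_class M A \<odot>\<^bsub>E\<^esub> y"
      using Ac x y by (intro rdist_definite) auto
  qed
qed

section \<open>The topology as convergence in probability\<close>

definition near :: "real \<Rightarrow> real \<Rightarrow> 'e \<Rightarrow> 'e \<Rightarrow> bool" where
  "near e l x y \<longleftrightarrow> prob {\<omega> \<in> space M. e \<le> rdist x y \<omega>} < l"

lemma el_nhd_iff_near:
  assumes "x \<in> carrier E" "y \<in> carrier E"
  shows "x \<ominus>\<^bsub>E\<^esub> y \<in> el_nhd M E nrm e l \<longleftrightarrow> near e l x y"
proof -
  have [measurable]: "rdist x y \<in> borel_measurable M" using assms by (rule measurable_rdist)
  have "{\<omega> \<in> space M. rdist x y \<omega> < e} = space M - {\<omega> \<in> space M. e \<le> rdist x y \<omega>}" by auto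
  then have "prob {\<omega> \<in> space M. rdist x y \<omega> < e} = 1 - prob {\<omega> \<in> space M. e \<le> rdist x y \<omega>}"
    by (simp add: prob_compl)
  then show ?thesis using assms by (auto simp: el_nhd_def near_def rdist_def[symmetric])
qed

lemma near_mono:
  assumes "near e l x y" "e \<le> e'" "l \<le> l'" "x \<in> carrier E" "y \<in> carrier E"
  shows "near e' l' x y"
proof -
  have [measurable]: "rdist x y \<in> borel_measurable M" using assms by (simp add: measurable_rdist)
  have "prob {\<omega> \<in> space M. e' \<le> rdist x y \<omega>} \<le> prob {\<omega> \<in> space M. e \<le> rdist x y \<omega>}"
    by (rule finite_measure_mono) (use assms in auto)
  then show ?thesis using assms by (simp add: near_def)
qed

lemma near_commute:
  assumes "near e l x y" "x \<in> carrier E" "y \<in> carrier E"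
  shows "near e l y x"
proof -
  have [measurable]: "rdist x y \<in> borel_measurable M" using assms by (simp add: measurable_rdist)
  have "prob {\<omega> \<in> space M. e \<le> rdist y x \<omega>} \<le> prob {\<omega> \<in> space M. e \<le> rdist x y \<omega>}"
    by (rule finite_measure_mono_AE) (use AE_rdist_commute[of x y] assms in auto)
  then show ?thesis using assms by (simp add: near_def)
qed

text \<open>The union bound for the two exceptional events. Measuring the far event, instead of the
  close event that defines \<open>el_nhd\<close>, is what makes both parameters additive.\<close>

lemma near_triangle:
  assumes "near e l x y" "near e' l' y z"
    and "x \<in> carrier E" "y \<in> carrier E" "z \<in> carrier E"
  shows "near (e + e') (l + l') x z"
proof -
  have [measurable]: "rdist x y \<in> borel_measurable M" "rdist y z \<in> borel_measurable M"
    using assms by (simp_all add: measurable_rdist)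
  let ?A = "{\<omega> \<in> space M. e \<le> rdist x y \<omega>}" and ?B = "{\<omega> \<in> space M. e' \<le> rdist y z \<omega>}"
  have "prob {\<omega> \<in> space M. e + e' \<le> rdist x z \<omega>} \<le> prob (?A \<union> ?B)"
  proof (rule finite_measure_mono_AE)
    show "AE \<omega> in M. \<omega> \<in> {\<omega> \<in> space M. e + e' \<le> rdist x z \<omega>} \<longrightarrow> \<omega> \<in> ?A \<union> ?B"
      using AE_rdist_triangle[OF assms(3-5)] by eventually_elim auto
  qed measurable
  also have "\<dots> \<le> prob ?A + prob ?B" by (rule measure_Un_le) measurable
  finally show ?thesis using assms(1,2) by (simp add: near_def)
qed

lemma near_AE:
  assumes "AE \<omega> in M. rdist x y \<omega> < e" "0 < l"
  shows "near e l x y"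
proof -
  have "AE \<omega> in M. \<not> e \<le> rdist x y \<omega>" using assms(1) by eventually_elim simp
  then show ?thesis unfolding near_def using prob_eq_0_AE assms(2) by simp
qed

text \<open>A single parameter suffices because the neighbourhoods with equal radius and probability
  already form a base.\<close>

lemma limitin_el_topology_iff:
  assumes x: "\<And>n. x n \<in> carrier E" and g: "g \<in> carrier E"
  shows "limitin (el_topology M E nrm) x g sequentially \<longleftrightarrow>
    (\<forall>e>0. eventually (\<lambda>n. near e e (x n) g) sequentially)"
proof
  assume lim: "limitin (el_topology M E nrm) x g sequentially"
  show "\<forall>e>0. eventually (\<lambda>n. near e e (x n) g) sequentially"
  proof (intro allI impI)
    fix e :: real assume e: "e > 0"
    \<comment> \<open>An open set around \<open>g\<close> inside the \<open>e\<close>-neighbourhood: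
      a point with parameter \<open>a < e\<close> leaves slack \<open>e - a\<close>, of which the
      triangle inequality spends at most half. The cap \<open>1/2\<close> on \<open>d\<close> below
      keeps the probability parameter under 1.\<close>
    define U where "U = {y \<in> carrier E. \<exists>a<e. near a a y g}"
    have "el_open M E nrm U" unfolding el_open_def
    proof (intro conjI ballI)
      fix y assume "y \<in> U"
      then obtain a where y: "y \<in> carrier E" and a: "a < e" "near a a y g" by (auto simp: U_def)
      define d where "d = min ((e - a) / 2) (1/2)"
      have d: "d > 0" "d < 1" "d + a < e" using a by (auto simp: d_def min_def field_simps)
      have "z \<in> U" if z: "z \<in> carrier E" "z \<ominus>\<^bsub>E\<^esub> y \<in> el_nhd M E nrm d d" for z
      proof -
        have "near d d z y" using z y el_nhd_iff_near by blast
        then have "near (d + a) (d + a) z g" using near_triangle a z y g by blast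
        then show ?thesis using d z by (auto simp: U_def)
      qed
      then show "\<exists>\<epsilon>>0. \<exists>l>0. l < 1 \<and> {z \<in> carrier E. z \<ominus>\<^bsub>E\<^esub> y \<in> el_nhd M E nrm \<epsilon> l} \<subseteq> U"
        using d by blast
    qed (auto simp: U_def)
    moreover have "near (e/2) (e/2) g g"
      by (rule near_AE) (use AE_rdist_self[OF g] e in auto)
    then have "g \<in> U" using g e unfolding U_def by (auto intro!: exI[of _ "e/2"])
    ultimately have "eventually (\<lambda>n. x n \<in> U) sequentially"
      using lim by (simp add: limitin_def openin_el_topology)
    then show "eventually (\<lambda>n. near e e (x n) g) sequentially"
      by eventually_elim (use g near_mono in \<open>force simp: U_def\<close>)
  qed
next
  assume near: "\<forall>e>0. eventually (\<lambda>n. near e e (x n) g) sequentially"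
  have "el_open M E nrm (carrier E)"
    by (auto simp: el_open_def intro!: exI[of _ "1/2"])
  then have "g \<in> topspace (el_topology M E nrm)"
    using g by (meson openin_el_topology openin_subset subsetD)
  moreover have "eventually (\<lambda>n. x n \<in> U) sequentially" if U: "el_open M E nrm U" "g \<in> U" for U
  proof -
    obtain e l where e: "e > 0" "l > 0"
      and sub: "{y \<in> carrier E. y \<ominus>\<^bsub>E\<^esub> g \<in> el_nhd M E nrm e l} \<subseteq> U"
      using U unfolding el_open_def by blast
    have "eventually (\<lambda>n. near (min e l) (min e l) (x n) g) sequentially" using near e by simp
    then show ?thesis
    proof eventually_elim
      case (elim n)
      then have "near e l (x n) g" by (rule near_mono) (use x g in auto)
      then show ?case using sub x g by (auto simp: el_nhd_iff_near)
    qed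
  qed
  ultimately show "limitin (el_topology M E nrm) x g sequentially"
    by (simp add: limitin_def openin_el_topology)
qed

lemma el_Cauchy_iff:
  assumes x: "\<And>n. x n \<in> carrier E"
  shows "el_Cauchy M E nrm x \<longleftrightarrow> (\<forall>e>0. \<exists>N. \<forall>m\<ge>N. \<forall>n\<ge>N. near e e (x m) (x n))"
proof
  assume C: "el_Cauchy M E nrm x"
  show "\<forall>e>0. \<exists>N. \<forall>m\<ge>N. \<forall>n\<ge>N. near e e (x m) (x n)"
  proof (intro allI impI)
    fix e :: real assume "e > 0"
    define d where "d = min e (1/2)"
    have d: "d > 0" "d < 1" "d \<le> e" using \<open>e > 0\<close> by (auto simp: d_def)
    obtain N where N: "\<forall>m\<ge>N. \<forall>n\<ge>N. x m \<ominus>\<^bsub>E\<^esub> x n \<in> el_nhd M E nrm d d"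
      using C d unfolding el_Cauchy_def by blast
    have "near e e (x m) (x n)" if "m \<ge> N" "n \<ge> N" for m n
    proof (rule near_mono)
      show "near d d (x m) (x n)" using N that x by (simp add: el_nhd_iff_near)
    qed (use d x in auto)
    then show "\<exists>N. \<forall>m\<ge>N. \<forall>n\<ge>N. near e e (x m) (x n)" by blast
  qed
next
  assume C: "\<forall>e>0. \<exists>N. \<forall>m\<ge>N. \<forall>n\<ge>N. near e e (x m) (x n)"
  show "el_Cauchy M E nrm x" unfolding el_Cauchy_def
  proof (intro allI impI)
    fix e l :: real assume "e > 0" "l > 0"
    then have "min e l > 0" by simp
    then obtain N where N: "\<forall>m\<ge>N. \<forall>n\<ge>N. near (min e l) (min e l) (x m) (x n)"
      using C by blast
    have "near e l (x m) (x n)" if "m \<ge> N" "n \<ge> N" for m n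
    proof (rule near_mono)
      show "near (min e l) (min e l) (x m) (x n)" using N that by simp
    qed (use x in auto)
    then show "\<exists>N. \<forall>m\<ge>N. \<forall>n\<ge>N. x m \<ominus>\<^bsub>E\<^esub> x n \<in> el_nhd M E nrm e l"
      using x by (auto simp: el_nhd_iff_near)
  qed
qed

section \<open>Concatenation, random subsequences and hulls\<close>

lemma countable_partition_level_sets:
  assumes [measurable]: "N \<in> measurable M (count_space UNIV)"
  shows "countable_partition M (\<lambda>l. {\<omega> \<in> space M. N \<omega> = l})"
proof -
  have "{\<omega> \<in> space M. N \<omega> = l} \<in> sets M" for l by measurable
  then show ?thesis by (auto simp: countable_partition_def disjoint_family_on_def)
qed

text \<open>Stability provides an element with the prescribed pieces, and
  \<open>concat_unique\<close> identifies it with the one described by \<open>concat_seq\<close>.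
  This is the selection principle behind every gluing below: a measurable natural-valued
  \<open>N\<close> yields an element of \<open>G\<close> that almost surely represents
  \<open>x (N \<omega>)\<close>.\<close>

lemma concat_level_sets:
  assumes G: "sigma_stable M E G" and x: "range x \<subseteq> G"
    and N: "N \<in> measurable M (count_space UNIV)"
  defines "g \<equiv> concat_seq M E (\<lambda>l. {\<omega> \<in> space M. N \<omega> = l}) x"
  shows "g \<in> G" and "AE \<omega> in M. rdist g (x (N \<omega>)) \<omega> = 0"
proof -
  let ?A = "\<lambda>l. {\<omega> \<in> space M. N \<omega> = l}"
  note part = countable_partition_level_sets[OF N]
  have Gc: "G \<subseteq> carrier E" using G by (simp add: sigma_stable_def)
  obtain h where h: "h \<in> G" "\<And>n. ind_class M (?A n) \<odot>\<^bsub>E\<^esub> h = ind_class M (?A n) \<odot>\<^bsub>E\<^esub> x n"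
    using G x part unfolding sigma_stable_def by blast
  have gh: "g = h" unfolding g_def concat_seq_def
  proof (rule the_equality)
    fix y assume "y \<in> carrier E \<and>
      (\<forall>n. ind_class M (?A n) \<odot>\<^bsub>E\<^esub> y = ind_class M (?A n) \<odot>\<^bsub>E\<^esub> x n)"
    then show "y = h" using concat_unique[OF part] h Gc by auto
  qed (use h Gc in auto)
  then show "g \<in> G" using h by simp
  have "AE \<omega> in M. \<omega> \<in> ?A n \<longrightarrow> rdist h (x n) \<omega> = 0" for n
  proof (subst ind_smult_eq_iff[symmetric])
    show "?A n \<in> sets M" using part by (auto simp: countable_partition_def)
  qed (use h x Gc in auto)
  then have "AE \<omega> in M. \<forall>n. \<omega> \<in> ?A n \<longrightarrow> rdist h (x n) \<omega> = 0"
    by (subst AE_all_countable) blast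
  then show "AE \<omega> in M. rdist g (x (N \<omega>)) \<omega> = 0"
    using AE_space unfolding gh by eventually_elim auto
qed

lemma random_subseq_props:
  assumes "sigma_stable M E G" "range x \<subseteq> G" "random_indices M n"
  shows "random_subseq M E x n k \<in> G"
    and "AE \<omega> in M. rdist (random_subseq M E x n k) (x (n k \<omega>)) \<omega> = 0"
  using concat_level_sets[OF assms(1,2), of "n k"] assms(3)
  by (auto simp: random_subseq_def random_indices_def)

lemma random_indices_ge:
  assumes "random_indices M n" "\<omega> \<in> space M"
  shows "k \<le> n k \<omega>"
proof (induction k)
  case (Suc k)
  have "n k \<omega> < n (Suc k) \<omega>" using assms by (simp add: random_indices_def)
  then show ?case using Suc by simp
qed simp

text \<open>Disjoint indicators are orthogonal idempotents, so multiplying the sum by the indicator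
  of \<open>A h\<close> leaves only the summand of \<open>h\<close>; then
  \<open>ind_smult_eq_iff\<close> applies.\<close>

lemma AE_rdist_finsum:
  assumes H: "finite H" "H \<subseteq> carrier E" and A: "A ` H \<subseteq> sets M" "disjoint_family_on A H"
    and h: "h \<in> H"
  shows "(\<Oplus>\<^bsub>E\<^esub>h\<in>H. ind_class M (A h) \<odot>\<^bsub>E\<^esub> h) \<in> carrier E"
    and "AE \<omega> in M. \<omega> \<in> A h \<longrightarrow> rdist (\<Oplus>\<^bsub>E\<^esub>h\<in>H. ind_class M (A h) \<odot>\<^bsub>E\<^esub> h) h \<omega> = 0"
proof -
  let ?I = "\<lambda>h. ind_class M (A h) :: ('w \<Rightarrow> 'k) set"
  have I: "?I h \<in> carrier (L0 M)" if "h \<in> H" for h using A that by (auto intro: ind_class_carrier)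
  have f: "(\<lambda>h. ?I h \<odot>\<^bsub>E\<^esub> h) \<in> H \<rightarrow> carrier E" using I H by auto
  then show c: "(\<Oplus>\<^bsub>E\<^esub>h\<in>H. ?I h \<odot>\<^bsub>E\<^esub> h) \<in> carrier E" by (rule M.finsum_closed)
  have *: "?I h \<odot>\<^bsub>E\<^esub> (?I h' \<odot>\<^bsub>E\<^esub> h') = (if h = h' then ?I h' \<odot>\<^bsub>E\<^esub> h' else \<zero>\<^bsub>E\<^esub>)"
    if h': "h' \<in> H" for h'
  proof -
    have [measurable]: "A h \<in> sets M" "A h' \<in> sets M" using A h h' by auto
    have dj: "h \<noteq> h' \<Longrightarrow> A h \<inter> A h' = {}" using A(2) h h' by (auto simp: disjoint_family_on_def)
    have "?I h \<otimes>\<^bsub>L0 M\<^esub> ?I h' = ae_class M (\<lambda>\<omega>. indicator (A h) \<omega> * indicator (A h') \<omega>)"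
      unfolding ind_class_def by (rule L0_mult_class) measurable
    also have "(\<lambda>\<omega>. indicator (A h) \<omega> * indicator (A h') \<omega> :: 'k) =
        (if h = h' then indicator (A h') else (\<lambda>_. 0))"
      using dj by (auto simp: fun_eq_iff split: split_indicator)
    also have "ae_class M \<dots> = (if h = h' then ?I h' else \<zero>\<^bsub>L0 M\<^esub>)"
      by (simp add: ind_class_def L0_zero)
    finally have "?I h \<otimes>\<^bsub>L0 M\<^esub> ?I h' = (if h = h' then ?I h' else \<zero>\<^bsub>L0 M\<^esub>)" .
    moreover have "?I h \<odot>\<^bsub>E\<^esub> (?I h' \<odot>\<^bsub>E\<^esub> h') = (?I h \<otimes>\<^bsub>L0 M\<^esub> ?I h') \<odot>\<^bsub>E\<^esub> h'"
      using I h h' H by (subst smult_assoc1) auto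
    ultimately show ?thesis using h' H by auto
  qed
  have "?I h \<odot>\<^bsub>E\<^esub> (\<Oplus>\<^bsub>E\<^esub>h\<in>H. ?I h \<odot>\<^bsub>E\<^esub> h) = (\<Oplus>\<^bsub>E\<^esub>h'\<in>H. ?I h \<odot>\<^bsub>E\<^esub> (?I h' \<odot>\<^bsub>E\<^esub> h'))"
    using H I h f by (intro finsum_smult_ldistr) auto
  also have "\<dots> = (\<Oplus>\<^bsub>E\<^esub>h'\<in>H. if h = h' then ?I h' \<odot>\<^bsub>E\<^esub> h' else \<zero>\<^bsub>E\<^esub>)"
    using * f by (intro M.finsum_cong') auto
  also have "\<dots> = ?I h \<odot>\<^bsub>E\<^esub> h" using h H f by (intro M.finsum_singleton) auto
  finally show "AE \<omega> in M. \<omega> \<in> A h \<longrightarrow> rdist (\<Oplus>\<^bsub>E\<^esub>h\<in>H. ?I h \<odot>\<^bsub>E\<^esub> h) h \<omega> = 0"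
    using A h H c by (subst ind_smult_eq_iff[symmetric]) auto
qed

lemma sigma_hull_AE:
  assumes H: "finite H" "H \<subseteq> carrier E" "H \<noteq> {}" and y: "y \<in> sigma_hull M E H"
  shows "y \<in> carrier E" and "AE \<omega> in M. \<exists>h\<in>H. rdist y h \<omega> = 0"
proof -
  obtain A where A: "A ` H \<subseteq> sets M" "disjoint_family_on A H" "(\<Union>h\<in>H. A h) = space M"
    and eq: "y = (\<Oplus>\<^bsub>E\<^esub>h\<in>H. ind_class M (A h) \<odot>\<^bsub>E\<^esub> h)"
    using y by (auto simp: sigma_hull_def)
  note fs = AE_rdist_finsum[OF H(1,2) A(1,2), folded eq]
  show "y \<in> carrier E" using fs(1) H by blast
  have "AE \<omega> in M. \<forall>h\<in>H. \<omega> \<in> A h \<longrightarrow> rdist y h \<omega> = 0"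
    using fs(2) H by (simp add: AE_finite_all)
  then show "AE \<omega> in M. \<exists>h\<in>H. rdist y h \<omega> = 0"
    using AE_space by eventually_elim (use A(3) in blast)
qed

lemma sigma_hull_select:
  assumes x: "\<And>i. x i \<in> carrier E"
    and N[measurable]: "N \<in> measurable M (count_space UNIV)" and le: "\<And>\<omega>. N \<omega> \<le> n"
  shows "\<exists>y\<in>sigma_hull M E (x ` {..n::nat}). y \<in> carrier E \<and> (AE \<omega> in M. rdist y (x (N \<omega>)) \<omega> = 0)"
proof -
  let ?H = "x ` {..n}"
  \<comment> \<open>Blocks are indexed by points, not by indices: \<open>sigma_hull\<close> sums
    over a set, so indices with the same value of \<open>x\<close> must share a block.\<close>
  define A where "A h = {\<omega> \<in> space M. x (N \<omega>) = h}" for h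
  let ?y = "\<Oplus>\<^bsub>E\<^esub>h\<in>?H. ind_class M (A h) \<odot>\<^bsub>E\<^esub> h"
  have xN: "x (N \<omega>) \<in> ?H" for \<omega> using le by auto
  have A: "A ` ?H \<subseteq> sets M" "disjoint_family_on A ?H" "(\<Union>h\<in>?H. A h) = space M"
    using xN unfolding A_def by (auto simp: disjoint_family_on_def)
  have Hc: "?H \<subseteq> carrier E" using x by auto
  note fs = AE_rdist_finsum[OF finite_imageI[OF finite_atMost] Hc A(1,2)]
  have "AE \<omega> in M. \<forall>h\<in>?H. \<omega> \<in> A h \<longrightarrow> rdist ?y h \<omega> = 0"
    using fs(2) by (subst AE_finite_all) auto
  then have "AE \<omega> in M. rdist ?y (x (N \<omega>)) \<omega> = 0"
    using AE_space by eventually_elim (use xN in \<open>auto simp: A_def\<close>)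
  moreover have "?y \<in> sigma_hull M E ?H" using A by (auto simp: sigma_hull_def)
  moreover have "?y \<in> carrier E" using fs(1)[of "x 0"] by auto
  ultimately show ?thesis by blast
qed

text \<open>Triangle inequalities through points at distance zero. The zero conditions stand inside
  the almost sure statement so that, after quantifying over a countable family, the selected points
  may vary with \<open>\<omega>\<close>.\<close>

lemma AE_rdist_cong:
  assumes "x \<in> carrier E" "y \<in> carrier E" "x' \<in> carrier E" "y' \<in> carrier E"
  shows "AE \<omega> in M. rdist x x' \<omega> = 0 \<longrightarrow> rdist y y' \<omega> = 0 \<longrightarrow> rdist x y \<omega> = rdist x' y' \<omega>"
  using AE_rdist_triangle[of x x' y] AE_rdist_triangle[of x' y' y] AE_rdist_triangle[of x' x y']
    AE_rdist_triangle[of x y y'] AE_rdist_commute[of x x'] AE_rdist_commute[of y y'] assms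
  by auto

section \<open>Compactness implies completeness\<close>

lemma random_seq_compact_imp_el_complete:
  assumes G: "sigma_stable M E G" and R: "random_seq_compact M E nrm G"
  shows "el_complete M E nrm G"
  unfolding el_complete_def
proof (intro allI impI, elim conjE)
  fix x assume x: "range x \<subseteq> G" and C: "el_Cauchy M E nrm x"
  have Gc: "G \<subseteq> carrier E" using G by (simp add: sigma_stable_def)
  then have xc: "x i \<in> carrier E" for i using x by auto
  have "\<exists>N. \<forall>m\<ge>N. \<forall>n\<ge>N. near ((1/2)^j) ((1/2)^j) (x m) (x n)" for j :: nat
    using C by (simp add: el_Cauchy_iff xc)
  then obtain N where
    N: "\<And>j m n. m \<ge> N j \<Longrightarrow> n \<ge> N j \<Longrightarrow> near ((1/2)^j) ((1/2)^j) (x m) (x n)"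
    by metis
  \<comment> \<open>Partial sums give monotone indices with \<open>\<phi> j \<ge> N j\<close>, which
    makes consecutive terms of \<open>z\<close> close at the summable rate
    \<open>(1/2)^j\<close>.\<close>
  define \<phi> where "\<phi> j = (\<Sum>i\<le>j. N i)" for j
  have \<phi>: "N j \<le> \<phi> j" "\<phi> j \<le> \<phi> (Suc j)" for j
    unfolding \<phi>_def by (auto intro: member_le_sum)
  define z where "z j = x (\<phi> j)" for j
  have zG: "range z \<subseteq> G" and zc: "z j \<in> carrier E" for j using x xc by (auto simp: z_def)
  note [measurable] = measurable_rdist[OF zc zc]
  have zn: "near ((1/2)^j) ((1/2)^j) (z j) (z (Suc j))" for j
    unfolding z_def by (rule N) (use \<phi>[of j] in auto)
  obtain n g where n: "random_indices M n" and g: "g \<in> G"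
    and lim: "limitin (el_topology M E nrm) (random_subseq M E z n) g sequentially"
    using R zG unfolding random_seq_compact_def by blast
  define y where "y = random_subseq M E z n"
  have yc: "y j \<in> carrier E" and yz: "AE \<omega> in M. rdist (y j) (z (n j \<omega>)) \<omega> = 0" for j
    using random_subseq_props[OF G zG n, of j] Gc by (auto simp: y_def)
  \<comment> \<open>\<open>B i\<close> is the event of a long jump from \<open>z (i+j)\<close>. Off
    all of them the path from \<open>z j\<close> to any term from \<open>j\<close> on is shorter
    than \<open>2 * (1/2)^j\<close>, and \<open>n j \<omega> \<ge> j\<close> makes
    \<open>y j\<close> such a term. The events have total probability at most
    \<open>2 * (1/2)^j\<close>; the factor 3 gives the strict bound that \<open>near\<close> asks
    for.\<close>
  have zy: "near (2 * (1/2)^j) (3 * (1/2)^j) (z j) (y j)" for j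
  proof -
    define B where "B i = {\<omega> \<in> space M. (1/2)^(i+j) \<le> rdist (z (i+j)) (z (Suc (i+j))) \<omega>}" for i
    have [measurable]: "B i \<in> sets M" for i unfolding B_def by measurable
    have B: "prob (B i) \<le> (1/2)^(i+j)" for i
      using zn[of "i+j"] by (simp add: B_def near_def)
    have geo: "(\<lambda>i. (1/2)^(i+j)) sums (2 * (1/2)^j :: real)"
      using sums_mult2[OF geometric_sums[of "1/2 :: real"], of "(1/2)^j"] by (simp add: power_add)
    have sB: "summable (\<lambda>i. prob (B i))"
      by (rule summable_comparison_test'[OF sums_summable[OF geo], of 0]) (use B in auto)
    have "prob {\<omega> \<in> space M. 2 * (1/2)^j \<le> rdist (z j) (y j) \<omega>} \<le> prob (\<Union>i. B i)"
    proof (rule finite_measure_mono_AE)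
      have "AE \<omega> in M. \<forall>l. rdist (y j) (z l) \<omega> = 0 \<longrightarrow> rdist (z j) (y j) \<omega> = rdist (z j) (z l) \<omega>"
      proof (subst AE_all_countable, rule allI)
        fix l show "AE \<omega> in M. rdist (y j) (z l) \<omega> = 0 \<longrightarrow> rdist (z j) (y j) \<omega> = rdist (z j) (z l) \<omega>"
          using AE_rdist_cong[of "z j" "y j" "z j" "z l"] AE_rdist_self[of "z j"] zc yc by auto
      qed
      with yz[of j] AE_rdist_pseudometric[of z, OF zc] AE_space
      show "AE \<omega> in M. \<omega> \<in> {\<omega> \<in> space M. 2 * (1/2)^j \<le> rdist (z j) (y j) \<omega>} \<longrightarrow> \<omega> \<in> (\<Union>i. B i)"
      proof eventually_elim
        case (elim \<omega>)
        show ?case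
        proof (rule impI, rule ccontr)
          assume far: "\<omega> \<in> {\<omega> \<in> space M. 2 * (1/2)^j \<le> rdist (z j) (y j) \<omega>}"
            and nB: "\<omega> \<notin> (\<Union>i. B i)"
          have "rdist (z j) (z (n j \<omega>)) \<omega> \<le> 2 * (1/2)^j - 2 * (1/2)^(n j \<omega>)"
          proof (rule geometric_chain[where D = "\<lambda>a b. rdist (z a) (z b) \<omega>"])
            fix i assume "j \<le> i"
            then have "i = (i - j) + j" by simp
            then show "rdist (z i) (z (Suc i)) \<omega> < (1/2)^i"
              using nB elim(3) unfolding B_def by (metis (mono_tags, lifting) UN_I UNIV_I mem_Collect_eq not_le)
          qed (use elim(2) random_indices_ge[OF n elim(3)] in auto)
          moreover have "0 < (1/2::real)^(n j \<omega>)" by simp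
          ultimately have "rdist (z j) (z (n j \<omega>)) \<omega> < 2 * (1/2)^j" by linarith
          then show False using elim(1,4) far by simp
        qed
      qed
    qed measurable
    also have "\<dots> \<le> (\<Sum>i. prob (B i))"
      by (rule finite_measure_subadditive_countably) (use sB in auto)
    also have "\<dots> \<le> (\<Sum>i. (1/2)^(i+j))"
      by (rule suminf_le[OF B sB sums_summable[OF geo]])
    also have "\<dots> = 2 * (1/2)^j" using geo by (rule sums_unique[symmetric])
    also have "\<dots> < 3 * (1/2)^j" by simp
    finally show ?thesis by (simp add: near_def)
  qed
  have gc: "g \<in> carrier E" using g Gc by auto
  have "eventually (\<lambda>m. near e e (x m) g) sequentially" if e: "e > 0" for e
  proof -
    \<comment> \<open>The path from \<open>x m\<close> through \<open>z j\<close> and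
      \<open>y j\<close> to \<open>g\<close> costs \<open>3 * (1/2)^j + e/2\<close> in distance and
      \<open>4 * (1/2)^j + e/2\<close> in probability; both stay below \<open>e\<close>.\<close>
    have "eventually (\<lambda>j. (1/2)^j < e/8) sequentially"
      by (rule order_tendstoD(2)[OF LIMSEQ_power_zero]) (use e in auto)
    moreover have "eventually (\<lambda>j. near (e/2) (e/2) (y j) g) sequentially"
      using lim limitin_el_topology_iff[of y, OF yc gc] e by (simp add: y_def)
    ultimately have "eventually (\<lambda>j. (1/2)^j < e/8 \<and> near (e/2) (e/2) (y j) g) sequentially"
      by eventually_elim simp
    then obtain j where j: "(1/2)^j < e/8" "near (e/2) (e/2) (y j) g"
      using eventually_happens by force
    have "near e e (x m) g" if "m \<ge> \<phi> j" for m
    proof (rule near_mono)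
      have "near ((1/2)^j) ((1/2)^j) (x m) (z j)"
        unfolding z_def by (rule N) (use \<phi>(1)[of j] that in auto)
      from near_triangle[OF near_triangle[OF this zy] j(2)]
      show "near ((1/2)^j + 2 * (1/2)^j + e/2) ((1/2)^j + 3 * (1/2)^j + e/2) (x m) g"
        using xc zc yc gc by blast
    qed (use j e xc gc in auto)
    then show ?thesis by (auto simp: eventually_sequentially)
  qed
  then show "\<exists>g\<in>G. limitin (el_topology M E nrm) x g sequentially"
    using g limitin_el_topology_iff[of x, OF xc gc] by blast
qed

section \<open>Compactness implies random total boundedness\<close>

lemma sigma_stable_maximal:
  assumes G: "sigma_stable M E G"
    and Q: "\<And>g. g \<in> G \<Longrightarrow> Measurable.pred M (Q g)"
    and local: "\<And>g h. g \<in> G \<Longrightarrow> h \<in> G \<Longrightarrow> AE \<omega> in M. rdist g h \<omega> = 0 \<longrightarrow> Q g \<omega> = Q h \<omega>"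
  shows "\<exists>r\<in>G. \<forall>g\<in>G. AE \<omega> in M. Q g \<omega> \<longrightarrow> Q r \<omega>"
proof -
  \<comment> \<open>By \<open>local\<close>, the truth of \<open>Q g\<close> at
    \<open>\<omega>\<close> depends on \<open>g\<close> only up to distance zero there, so gluing
    elements glues their events.\<close>
  have glue: "\<exists>g\<in>G. AE \<omega> in M. Q g \<omega> = Q (x (N \<omega>)) \<omega>"
    if x: "range x \<subseteq> G" and N: "N \<in> measurable M (count_space UNIV)" for x and N :: "'w \<Rightarrow> nat"
  proof -
    obtain g where g: "g \<in> G" "AE \<omega> in M. rdist g (x (N \<omega>)) \<omega> = 0"
      using concat_level_sets[OF G x N] by blast
    have "AE \<omega> in M. \<forall>k. rdist g (x k) \<omega> = 0 \<longrightarrow> Q g \<omega> = Q (x k) \<omega>"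
      by (subst AE_all_countable) (intro allI local g(1) range_subsetD[OF x])
    with g(2) have "AE \<omega> in M. Q g \<omega> = Q (x (N \<omega>)) \<omega>" by eventually_elim auto
    then show ?thesis using g by blast
  qed
  \<comment> \<open>Exhaustion: the probability \<open>p\<close> attains its supremum on
    \<open>G\<close>, and a maximiser in probability turns out to be maximal up to null
    sets.\<close>
  define p where "p g = prob {\<omega> \<in> space M. Q g \<omega>}" for g
  have bdd: "bdd_above (p ` G)" by (auto simp: p_def bdd_above_def intro!: exI[of _ 1])
  have ne: "G \<noteq> {}" using G by (simp add: sigma_stable_def)
  have "\<exists>g\<in>G. Sup (p ` G) - 1 / real (Suc k) < p g" for k
    using less_cSUP_iff[OF ne bdd, of "Sup (p ` G) - 1 / real (Suc k)"] by simp
  then obtain x where xG: "\<And>k. x k \<in> G" and xp: "\<And>k. Sup (p ` G) - 1 / real (Suc k) < p (x k)"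
    by metis
  note [measurable] = Q[OF xG]
  \<comment> \<open>Gluing a maximising sequence along the first index whose event occurs yields an
    \<open>r\<close> whose event almost surely contains all of theirs. Where none occurs, any value
    of \<open>LEAST\<close> will do.\<close>
  obtain r where r: "r \<in> G" and rQ: "AE \<omega> in M. Q r \<omega> = Q (x (LEAST k. Q (x k) \<omega>)) \<omega>"
    using glue[of x "\<lambda>\<omega>. LEAST k. Q (x k) \<omega>"] xG by auto
  note [measurable] = Q[OF r]
  have "p (x k) \<le> p r" for k unfolding p_def
  proof (rule finite_measure_mono_AE)
    show "AE \<omega> in M. \<omega> \<in> {\<omega> \<in> space M. Q (x k) \<omega>} \<longrightarrow> \<omega> \<in> {\<omega> \<in> space M. Q r \<omega>}"
      using rQ by eventually_elim (auto intro: LeastI)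
  qed measurable
  with xp have "Sup (p ` G) - p r < 1 / real (Suc k)" for k
    by (smt (verit))
  then have sup: "Sup (p ` G) \<le> p r"
    by (metis diff_gt_0_iff_gt less_le_not_le nat_approx_posE not_less)
  have "AE \<omega> in M. Q g \<omega> \<longrightarrow> Q r \<omega>" if g: "g \<in> G" for g
  proof -
    note [measurable] = Q[OF g]
    \<comment> \<open>\<open>h\<close> follows \<open>r\<close> where \<open>Q r\<close> holds and
      \<open>g\<close> elsewhere. Its event gains all of \<open>?D\<close> over that of
      \<open>r\<close>, so maximality of \<open>p r\<close> forces \<open>?D\<close> to be
      null.\<close>
    obtain h where h: "h \<in> G"
      and hQ: "AE \<omega> in M. Q h \<omega> = Q ((\<lambda>i::nat. if i = 0 then r else g) (if Q r \<omega> then 0 else 1)) \<omega>"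
      using glue[of "\<lambda>i. if i = 0 then r else g" "\<lambda>\<omega>. if Q r \<omega> then 0 else 1"] r g by auto
    note [measurable] = Q[OF h]
    let ?R = "{\<omega> \<in> space M. Q r \<omega>}" and ?D = "{\<omega> \<in> space M. Q g \<omega> \<and> \<not> Q r \<omega>}"
    have "prob ?R + prob ?D = prob (?R \<union> ?D)"
      by (rule finite_measure_Union[symmetric]) auto
    also have "\<dots> \<le> p h" unfolding p_def
    proof (rule finite_measure_mono_AE)
      show "AE \<omega> in M. \<omega> \<in> ?R \<union> ?D \<longrightarrow> \<omega> \<in> {\<omega> \<in> space M. Q h \<omega>}"
        using hQ by eventually_elim auto
    qed measurable
    also have "\<dots> \<le> p r" using sup cSUP_upper[OF h bdd] by simp
    finally have "prob ?D = 0" using measure_nonneg[of M ?D] by (simp add: p_def)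
    then show ?thesis by (subst (asm) prob_Collect_eq_0) auto
  qed
  then show ?thesis using r by blast
qed

text \<open>The indices of a random subsequence increase strictly at every \<open>\<omega>\<close>,
  so on the event where all points are \<open>ep\<close>-separated its consecutive terms stay
  \<open>ep\<close> apart, while convergence makes them close in probability.\<close>

lemma separated_event_null:
  fixes x :: "nat \<Rightarrow> 'e"
  assumes G: "sigma_stable M E G" and R: "random_seq_compact M E nrm G"
    and x: "range x \<subseteq> G" and [measurable]: "ep \<in> borel_measurable M"
    and pos: "AE \<omega> in M. 0 < ep \<omega>"
  shows "AE \<omega> in M. \<exists>n. \<exists>i<n. rdist (x n) (x i) \<omega> < ep \<omega>"
proof -
  have Gc: "G \<subseteq> carrier E" using G by (simp add: sigma_stable_def)
  then have xc: "x i \<in> carrier E" for i using x by auto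
  note [measurable] = measurable_rdist[OF xc xc]
  define S where "S \<omega> \<longleftrightarrow> (\<forall>n. \<forall>i<n. ep \<omega> \<le> rdist (x n) (x i) \<omega>)" for \<omega>
  have sep: "Measurable.pred M (\<lambda>\<omega>. i < n \<longrightarrow> ep \<omega> \<le> rdist (x n) (x i) \<omega>)" for i n
    by measurable
  have [measurable]: "Measurable.pred M S" unfolding S_def by (intro pred_intros_countable sep)
  obtain n g where n: "random_indices M n" and g: "g \<in> G"
    and lim: "limitin (el_topology M E nrm) (random_subseq M E x n) g sequentially"
    using R x unfolding random_seq_compact_def by blast
  define y where "y = random_subseq M E x n"
  have yc: "y j \<in> carrier E" and yx: "AE \<omega> in M. rdist (y j) (x (n j \<omega>)) \<omega> = 0" for j
    using random_subseq_props[OF G x n, of j] Gc by (auto simp: y_def)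
  have gc: "g \<in> carrier E" using g Gc by auto
  note [measurable] = measurable_rdist[OF yc yc]
  have small: "prob {\<omega> \<in> space M. S \<omega> \<and> d \<le> ep \<omega>} < d" if d: "d > 0" for d
  proof -
    obtain k where k: "\<And>j. j \<ge> k \<Longrightarrow> near (d/2) (d/2) (y j) g"
      using lim limitin_el_topology_iff[of y, OF yc gc] d
      by (auto simp: y_def eventually_sequentially dest!: spec[of _ "d/2"])
    have "near (d/2 + d/2) (d/2 + d/2) (y k) (y (Suc k))"
      by (rule near_triangle[OF k near_commute[OF k]]) (use yc gc in auto)
    then have "prob {\<omega> \<in> space M. d \<le> rdist (y k) (y (Suc k)) \<omega>} < d" by (simp add: near_def)
    moreover have "prob {\<omega> \<in> space M. S \<omega> \<and> d \<le> ep \<omega>} \<le>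
        prob {\<omega> \<in> space M. d \<le> rdist (y k) (y (Suc k)) \<omega>}"
    proof (rule finite_measure_mono_AE)
      have "AE \<omega> in M. \<forall>a b. rdist (y k) (x a) \<omega> = 0 \<longrightarrow> rdist (y (Suc k)) (x b) \<omega> = 0 \<longrightarrow>
          rdist (y k) (y (Suc k)) \<omega> = rdist (x a) (x b) \<omega>"
        unfolding AE_all_countable by (intro allI AE_rdist_cong yc xc)
      with yx[of k] yx[of "Suc k"] AE_rdist_pseudometric[of x, OF xc] AE_space
      show "AE \<omega> in M. \<omega> \<in> {\<omega> \<in> space M. S \<omega> \<and> d \<le> ep \<omega>} \<longrightarrow>
          \<omega> \<in> {\<omega> \<in> space M. d \<le> rdist (y k) (y (Suc k)) \<omega>}"
      proof eventually_elim
        case (elim \<omega>)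
        have "n k \<omega> < n (Suc k) \<omega>" using n elim(4) by (simp add: random_indices_def)
        moreover have "rdist (y k) (y (Suc k)) \<omega> = rdist (x (n (Suc k) \<omega>)) (x (n k \<omega>)) \<omega>"
          using elim(1,2,3,5) by metis
        ultimately show ?case using elim(4) by (fastforce simp: S_def)
      qed
    qed measurable
    ultimately show ?thesis by simp
  qed
  have "prob {\<omega> \<in> space M. S \<omega> \<and> c \<le> ep \<omega>} = 0" if c: "c > 0" for c
  proof (rule ccontr)
    let ?p = "prob {\<omega> \<in> space M. S \<omega> \<and> c \<le> ep \<omega>}"
    assume "?p \<noteq> 0"
    then have p: "?p > 0" using measure_nonneg[of M] by (simp add: less_le)
    \<comment> \<open>\<open>small\<close> bounds the probability only by the threshold itself.
      Lowering the threshold from \<open>c\<close> to \<open>min c ?p\<close> enlarges the event and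
      yet forces its probability below \<open>?p\<close>.\<close>
    have "?p \<le> prob {\<omega> \<in> space M. S \<omega> \<and> min c ?p \<le> ep \<omega>}"
      by (rule finite_measure_mono) auto
    also have "\<dots> < min c ?p" by (rule small) (use c p in auto)
    finally show False by simp
  qed
  then have "AE \<omega> in M. \<forall>j. \<not> (S \<omega> \<and> 1 / real (Suc j) \<le> ep \<omega>)"
    unfolding AE_all_countable by (intro allI prob_Collect_eq_0[THEN iffD1]) auto
  with pos show ?thesis
  proof eventually_elim
    case (elim \<omega>)
    obtain j where "1 / real (Suc j) < ep \<omega>" using nat_approx_posE[OF elim(1)] by blast
    then have "\<not> S \<omega>" using elim(2) less_imp_le by blast
    then show ?case by (auto simp: S_def not_le)
  qed
qed

lemma random_seq_compact_imp_random_totally_bounded: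
  assumes G: "sigma_stable M E G" and R: "random_seq_compact M E nrm G"
  shows "random_totally_bounded M E nrm G"
  unfolding random_totally_bounded_def
proof (intro conjI ballI)
  show "G \<noteq> {}" and Gc: "G \<subseteq> carrier E" using G by (auto simp: sigma_stable_def)
  fix \<epsilon> assume \<epsilon>: "\<epsilon> \<in> L0_pplus M"
  define ep where "ep = rep \<epsilon>"
  have [measurable]: "ep \<in> borel_measurable M"
    using \<epsilon> unfolding ep_def by (intro rep_in) (simp add: L0_pplus_def L0_def)
  have pos: "AE \<omega> in M. 0 < ep \<omega>"
  proof -
    have "AE \<omega> in M. rep (\<zero>\<^bsub>L0 M\<^esub>) \<omega> < ep \<omega>"
      using \<epsilon> by (simp add: ep_def L0_pplus_def L0_less_def)
    moreover have "AE \<omega> in M. rep (\<zero>\<^bsub>L0 M\<^esub>) \<omega> = (0::real)"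
      unfolding L0_zero by (rule rep_ae_class) simp
    ultimately show ?thesis by eventually_elim simp
  qed
  \<comment> \<open>Farness from the first \<open>n\<close> terms of \<open>f\<close>, vacuous for
    \<open>n = 0\<close>. Only those terms enter, which is the compatibility condition of
    \<open>dependent_wellorder_choice\<close>.\<close>
  define Q where "Q f n g \<omega> \<longleftrightarrow> (\<forall>i<n. ep \<omega> \<le> rdist g (f i) \<omega>)" for f :: "nat \<Rightarrow> 'e" and n g \<omega>
  have "\<exists>x. \<forall>n. x n \<in> G \<and> (\<forall>g\<in>G. AE \<omega> in M. Q x n g \<omega> \<longrightarrow> Q x n (x n) \<omega>)"
  proof (rule dependent_wellorder_choice)
    fix r and f h :: "nat \<Rightarrow> 'e" and n assume "\<And>i. i < n \<Longrightarrow> f i = h i"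
    then have "Q f n = Q h n" by (auto simp: Q_def fun_eq_iff)
    then show "(r \<in> G \<and> (\<forall>g\<in>G. AE \<omega> in M. Q f n g \<omega> \<longrightarrow> Q f n r \<omega>)) =
        (r \<in> G \<and> (\<forall>g\<in>G. AE \<omega> in M. Q h n g \<omega> \<longrightarrow> Q h n r \<omega>))" by simp
  next
    fix n and f :: "nat \<Rightarrow> 'e"
    assume "\<And>i. i < n \<Longrightarrow> f i \<in> G \<and> (\<forall>g\<in>G. AE \<omega> in M. Q f i g \<omega> \<longrightarrow> Q f i (f i) \<omega>)"
    then have f: "f i \<in> carrier E" if "i < n" for i using that Gc by blast
    have "\<exists>r\<in>G. \<forall>g\<in>G. AE \<omega> in M. Q f n g \<omega> \<longrightarrow> Q f n r \<omega>"
    proof (rule sigma_stable_maximal[OF G])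
      fix g assume "g \<in> G"
      then have "rdist g (f i) \<in> borel_measurable M" if "i < n" for i
        using measurable_rdist f Gc that by blast
      then have "Measurable.pred M (\<lambda>\<omega>. i < n \<longrightarrow> ep \<omega> \<le> rdist g (f i) \<omega>)" for i
        by (cases "i < n") auto
      then show "Measurable.pred M (Q f n g)" unfolding Q_def by (rule pred_intros_countable)
    next
      fix g h assume gh: "g \<in> G" "h \<in> G"
      have "AE \<omega> in M. rdist g h \<omega> = 0 \<longrightarrow> rdist g (f i) \<omega> = rdist h (f i) \<omega>" if i: "i < n" for i
        using AE_rdist_cong[of g "f i" h "f i"] AE_rdist_self[of "f i"] subsetD[OF Gc gh(1)]
          subsetD[OF Gc gh(2)] f[OF i] by auto
      then have "AE \<omega> in M. \<forall>i. i < n \<longrightarrow> rdist g h \<omega> = 0 \<longrightarrow> rdist g (f i) \<omega> = rdist h (f i) \<omega>"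
        unfolding AE_all_countable by auto
      then show "AE \<omega> in M. rdist g h \<omega> = 0 \<longrightarrow> Q f n g \<omega> = Q f n h \<omega>"
        by eventually_elim (auto simp: Q_def)
    qed
    then show "\<exists>r. r \<in> G \<and> (\<forall>g\<in>G. AE \<omega> in M. Q f n g \<omega> \<longrightarrow> Q f n r \<omega>)" by blast
  qed
  then obtain x where x: "\<And>n. x n \<in> G"
    and max: "\<And>n g. g \<in> G \<Longrightarrow> AE \<omega> in M. Q x n g \<omega> \<longrightarrow> Q x n (x n) \<omega>" by blast
  have xc: "x n \<in> carrier E" for n using x Gc by blast
  note [measurable] = measurable_rdist[OF xc xc]
  have "AE \<omega> in M. \<exists>n. \<exists>i<n. rdist (x n) (x i) \<omega> < ep \<omega>"
    by (rule separated_event_null[OF G R]) (use x pos in auto)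
  then have fin: "AE \<omega> in M. \<exists>n. \<not> Q x n (x n) \<omega>"
    by (simp add: Q_def not_le)
  have [measurable]: "Measurable.pred M (Q x n (x n))" for n unfolding Q_def by measurable
  \<comment> \<open>The first stage at which even the maximiser \<open>x n\<close> comes close to a
    predecessor; by \<open>fin\<close> it exists almost surely. By \<open>max\<close>, on the event
    \<open>N \<omega> = n\<close> each \<open>g \<in> G\<close> is almost surely close to one of
    \<open>x 0, ..., x (n - 1)\<close>.\<close>
  define N where "N \<omega> = (LEAST n. \<not> Q x n (x n) \<omega>)" for \<omega>
  have [measurable]: "N \<in> measurable M (count_space UNIV)" unfolding N_def by measurable
  let ?A = "\<lambda>n. {\<omega> \<in> space M. N \<omega> = n}"
  have "ind_image M E (?A n) G \<subseteq> ind_image M E (?A n) (rn_enlarge M E nrm (sigma_hull M E (x ` {..n})) \<epsilon>)"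
    for n
  proof
    fix u assume "u \<in> ind_image M E (?A n) G"
    then obtain g where g: "g \<in> G" and u: "u = ind_class M (?A n) \<odot>\<^bsub>E\<^esub> g"
      by (auto simp: ind_image_def)
    have gc: "g \<in> carrier E" using g Gc by blast
    note [measurable] = measurable_rdist[OF gc xc]
    \<comment> \<open>The first close index, with default 0. Taking \<open>{..n}\<close> for the
      hull keeps the finite set nonempty and makes it contain the default point even for
      \<open>n = 0\<close>.\<close>
    define I where "I \<omega> = (if \<exists>i<n. rdist g (x i) \<omega> < ep \<omega>
      then (LEAST i. i < n \<and> rdist g (x i) \<omega> < ep \<omega>) else 0)" for \<omega>
    have [measurable]: "I \<in> measurable M (count_space UNIV)" unfolding I_def by measurable
    have I: "I \<omega> < n \<and> rdist g (x (I \<omega>)) \<omega> < ep \<omega>" if "\<exists>i<n. rdist g (x i) \<omega> < ep \<omega>" for \<omega>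
      using LeastI_ex[of "\<lambda>i. i < n \<and> rdist g (x i) \<omega> < ep \<omega>"] that by (simp add: I_def)
    then have "I \<omega> \<le> n" for \<omega> by (cases "\<exists>i<n. rdist g (x i) \<omega> < ep \<omega>") (auto simp: I_def less_imp_le)
    then obtain y where y: "y \<in> sigma_hull M E (x ` {..n})" and yc: "y \<in> carrier E"
      and yI: "AE \<omega> in M. rdist y (x (I \<omega>)) \<omega> = 0"
      using sigma_hull_select[of x I n] xc by auto
    \<comment> \<open>The ball requires closeness on the whole space, but \<open>g\<close> is known
      to be close to \<open>y\<close> only on \<open>?A n\<close>. So \<open>z\<close> is glued from
      \<open>g\<close> there and from \<open>x (I \<omega>)\<close>, at distance zero from
      \<open>y\<close>, elsewhere; prepending \<open>g\<close> to \<open>x\<close> makes index 0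
      stand for \<open>g\<close>.\<close>
    define w where "w = case_nat g x"
    have wG: "range w \<subseteq> G" using g x by (auto simp: w_def split: nat.split)
    then have wc: "w i \<in> carrier E" for i using Gc by blast
    have [measurable]: "(\<lambda>\<omega>. if \<omega> \<in> ?A n then 0 else Suc (I \<omega>)) \<in> measurable M (count_space UNIV)"
      by measurable
    obtain z where z: "z \<in> G" and zw: "AE \<omega> in M. rdist z (w (if \<omega> \<in> ?A n then 0 else Suc (I \<omega>))) \<omega> = 0"
      using concat_level_sets[OF G wG, of "\<lambda>\<omega>. if \<omega> \<in> ?A n then 0 else Suc (I \<omega>)"] by auto
    have zc: "z \<in> carrier E" using z Gc by blast
    have zg: "AE \<omega> in M. \<omega> \<in> ?A n \<longrightarrow> rdist z g \<omega> = 0"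
      using zw by eventually_elim (auto simp: w_def)
    have "AE \<omega> in M. \<forall>i j. rdist z (w i) \<omega> = 0 \<longrightarrow> rdist y (x j) \<omega> = 0 \<longrightarrow>
        rdist z y \<omega> = rdist (w i) (x j) \<omega>"
      unfolding AE_all_countable by (intro allI AE_rdist_cong zc yc wc xc)
    with zw yI fin max[OF g, of n] pos AE_rdist_pseudometric[of x, OF xc] AE_space
    have "AE \<omega> in M. rdist z y \<omega> < ep \<omega>"
    proof eventually_elim
      case (elim \<omega>)
      show ?case
      proof (cases "\<omega> \<in> ?A n")
        case True
        then have "\<not> Q x n (x n) \<omega>" using LeastI_ex[OF elim(3)] by (simp add: N_def)
        then have "\<exists>i<n. rdist g (x i) \<omega> < ep \<omega>" using elim(4) by (auto simp: Q_def not_le)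
        then have "rdist g (x (I \<omega>)) \<omega> < ep \<omega>" using I by blast
        moreover have "rdist z (w 0) \<omega> = 0" using elim(1) True by simp
        then have "rdist z y \<omega> = rdist (w 0) (x (I \<omega>)) \<omega>" using elim(2,8) by blast
        ultimately show ?thesis by (simp add: w_def)
      next
        case False
        then have "rdist z (w (Suc (I \<omega>))) \<omega> = 0" using elim(1) by (simp split: if_splits)
        then have "rdist z y \<omega> = rdist (w (Suc (I \<omega>))) (x (I \<omega>)) \<omega>" using elim(2,8) by blast
        then show ?thesis using elim(5,6) by (simp add: w_def)
      qed
    qed
    then have "z \<in> rn_ball M E nrm y \<epsilon>"
      using zc by (simp add: rn_ball_def L0_less_def rdist_def ep_def)
    then have "z \<in> rn_enlarge M E nrm (sigma_hull M E (x ` {..n})) \<epsilon>"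
      using y by (auto simp: rn_enlarge_def)
    moreover have "u = ind_class M (?A n) \<odot>\<^bsub>E\<^esub> z"
      unfolding u using zg gc zc ind_smult_eq_iff[of "?A n" z g] by simp
    ultimately show "u \<in> ind_image M E (?A n) (rn_enlarge M E nrm (sigma_hull M E (x ` {..n})) \<epsilon>)"
      by (auto simp: ind_image_def)
  qed
  then show "\<exists>A Gs. countable_partition M A \<and>
      (\<forall>n. finite (Gs n) \<and> Gs n \<noteq> {} \<and> Gs n \<subseteq> G \<and> ind_image M E (A n) G \<subseteq>
        ind_image M E (A n) (rn_enlarge M E nrm (sigma_hull M E (Gs n)) \<epsilon>))"
    using x by (intro exI[of _ ?A] exI[of _ "\<lambda>n. x ` {..n}"] conjI allI)
      (auto intro!: countable_partition_level_sets)
qed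

section \<open>Random total boundedness and completeness imply compactness\<close>

lemma random_totally_bounded_cover:
  assumes T: "random_totally_bounded M E nrm G" and e: "(e::real) > 0"
  shows "\<exists>A Gs. countable_partition M A \<and> (\<forall>n. finite (Gs n) \<and> Gs n \<subseteq> G \<and>
    (\<forall>g\<in>G. AE \<omega> in M. \<omega> \<in> A n \<longrightarrow> (\<exists>h\<in>Gs n. rdist g h \<omega> < e)))"
proof -
  have Gc: "G \<subseteq> carrier E" using T by (simp add: random_totally_bounded_def)
  define \<epsilon> where "\<epsilon> = ae_class M (\<lambda>_::'w. e)"
  have repe: "AE \<omega> in M. rep \<epsilon> \<omega> = e" unfolding \<epsilon>_def by (rule rep_ae_class) simp
  have rep0: "AE \<omega> in M. rep (\<zero>\<^bsub>L0 M\<^esub>) \<omega> = (0::real)"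
    unfolding L0_zero by (rule rep_ae_class) simp
  have "AE \<omega> in M. rep (\<zero>\<^bsub>L0 M\<^esub>) \<omega> < rep \<epsilon> \<omega>"
    using repe rep0 by eventually_elim (use e in simp)
  then have "\<epsilon> \<in> L0_pplus M"
    by (simp add: L0_pplus_def L0_less_def) (simp add: \<epsilon>_def L0_carrierI)
  then obtain A Gs where A: "countable_partition M A"
    and Gs: "\<And>n. finite (Gs n) \<and> Gs n \<noteq> {} \<and> Gs n \<subseteq> G \<and> ind_image M E (A n) G \<subseteq>
        ind_image M E (A n) (rn_enlarge M E nrm (sigma_hull M E (Gs n)) \<epsilon>)"
    using T unfolding random_totally_bounded_def by blast
  \<comment> \<open>On \<open>A n\<close>, \<open>g\<close> agrees with some \<open>z\<close> close
    to a hull element \<open>y\<close>, and at almost every \<open>\<omega>\<close> this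
    \<open>y\<close> coincides with a point of \<open>Gs n\<close>. Up to a null set depending on
    \<open>g\<close>, the hull cover is thus a finite net at each \<open>\<omega>\<close>.\<close>
  have "AE \<omega> in M. \<omega> \<in> A n \<longrightarrow> (\<exists>h\<in>Gs n. rdist g h \<omega> < e)" if g: "g \<in> G" for g n
  proof -
    have gc: "g \<in> carrier E" using g Gc by blast
    have Gn: "finite (Gs n)" "Gs n \<subseteq> carrier E" "Gs n \<noteq> {}" using Gs[of n] Gc by auto
    have "ind_class M (A n) \<odot>\<^bsub>E\<^esub> g \<in> ind_image M E (A n) (rn_enlarge M E nrm (sigma_hull M E (Gs n)) \<epsilon>)"
      using Gs[of n] g by (auto simp: ind_image_def)
    then obtain y z where y: "y \<in> sigma_hull M E (Gs n)" and z: "z \<in> rn_ball M E nrm y \<epsilon>"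
      and eq: "ind_class M (A n) \<odot>\<^bsub>E\<^esub> g = ind_class M (A n) \<odot>\<^bsub>E\<^esub> z"
      by (auto simp: ind_image_def rn_enlarge_def)
    note hull = sigma_hull_AE[OF Gn y]
    have zc: "z \<in> carrier E" and zy: "AE \<omega> in M. rdist z y \<omega> < rep \<epsilon> \<omega>"
      using z by (simp_all add: rn_ball_def L0_less_def rdist_def)
    have "A n \<in> sets M" using A by (auto simp: countable_partition_def)
    then have gz: "AE \<omega> in M. \<omega> \<in> A n \<longrightarrow> rdist g z \<omega> = 0"
      using eq ind_smult_eq_iff gc zc by blast
    have "AE \<omega> in M. \<forall>h\<in>Gs n. rdist g h \<omega> \<le> rdist g y \<omega> + rdist y h \<omega>"
      using Gn gc hull(1) AE_rdist_triangle by (subst AE_finite_all) auto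
    with AE_rdist_triangle[OF gc zc hull(1)] hull(2) zy gz repe
    show ?thesis
    proof eventually_elim
      case (elim \<omega>)
      then obtain h where "h \<in> Gs n" "rdist y h \<omega> = 0" by blast
      then show ?case using elim by (intro impI bexI[of _ h]) force+
    qed
  qed
  then show ?thesis using A Gs by (intro exI[of _ A] exI[of _ Gs]) blast
qed

lemma complete_random_totally_bounded_imp_random_seq_compact:
  assumes G: "sigma_stable M E G" and T: "random_totally_bounded M E nrm G"
    and C: "el_complete M E nrm G"
  shows "random_seq_compact M E nrm G"
  unfolding random_seq_compact_def
proof (intro allI impI)
  fix x :: "nat \<Rightarrow> 'e" assume x: "range x \<subseteq> G"
  have Gc: "G \<subseteq> carrier E" using G by (simp add: sigma_stable_def)
  then have xc: "x i \<in> carrier E" for i using x by auto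
  \<comment> \<open>The radius is half the tolerance \<open>(1/2)^k\<close> of level
    \<open>k\<close>, as \<open>infinite_close_pairs\<close> requires.\<close>
  have "\<forall>k::nat. \<exists>A Gs. countable_partition M A \<and> (\<forall>n. finite (Gs n) \<and> Gs n \<subseteq> G \<and>
      (\<forall>g\<in>G. AE \<omega> in M. \<omega> \<in> A n \<longrightarrow> (\<exists>h\<in>Gs n. rdist g h \<omega> < (1/2)^k / 2)))"
    by (intro allI random_totally_bounded_cover[OF T]) simp
  then obtain A Gs where AGs: "\<forall>k. countable_partition M (A k) \<and> (\<forall>n. finite (Gs k n) \<and> Gs k n \<subseteq> G \<and>
      (\<forall>g\<in>G. AE \<omega> in M. \<omega> \<in> A k n \<longrightarrow> (\<exists>h\<in>Gs k n. rdist g h \<omega> < (1/2)^k / 2)))"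
    unfolding choice_iff by blast
  then have A: "\<And>k. countable_partition M (A k)"
    and Gs: "\<And>k n. finite (Gs k n)" "\<And>k n. Gs k n \<subseteq> G"
    and cov: "\<And>k n g. g \<in> G \<Longrightarrow> AE \<omega> in M. \<omega> \<in> A k n \<longrightarrow> (\<exists>h\<in>Gs k n. rdist g h \<omega> < (1/2)^k / 2)"
    by blast+
  \<comment> \<open>The centres of all levels form a countable set, so one null set covers all
    triangle inequalities through them.\<close>
  define K where "K = (\<Union>k n. Gs k n)"
  have K: "countable K"
    unfolding K_def by (intro countable_UN countableI_type) (simp add: Gs countable_finite)
  have Kc: "K \<subseteq> carrier E" using Gs(2) Gc unfolding K_def by blast
  have "AE \<omega> in M. \<forall>k n i. \<omega> \<in> A k n \<longrightarrow> (\<exists>h\<in>Gs k n. rdist (x i) h \<omega> < (1/2)^k / 2)"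
    unfolding AE_all_countable by (intro allI cov range_subsetD[OF x])
  moreover have "AE \<omega> in M. \<forall>h\<in>K. \<forall>i m. rdist (x i) (x m) \<omega> \<le> rdist (x i) h \<omega> + rdist (x m) h \<omega>"
    unfolding AE_ball_countable[OF K] AE_all_countable
  proof (intro ballI allI)
    fix h i m assume "h \<in> K"
    then have "h \<in> carrier E" using Kc by blast
    then show "AE \<omega> in M. rdist (x i) (x m) \<omega> \<le> rdist (x i) h \<omega> + rdist (x m) h \<omega>"
      using AE_rdist_triangle[of "x i" h "x m"] AE_rdist_commute[of "x m" h] xc by auto
  qed
  ultimately have "AE \<omega> in M. (\<forall>k n i. \<omega> \<in> A k n \<longrightarrow> (\<exists>h\<in>Gs k n. rdist (x i) h \<omega> < (1/2)^k / 2)) \<and>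
      (\<forall>h\<in>K. \<forall>i m. rdist (x i) (x m) \<omega> \<le> rdist (x i) h \<omega> + rdist (x m) h \<omega>)"
    by eventually_elim blast
  then obtain N where N: "N \<in> null_sets M"
    and good: "\<And>\<omega>. \<omega> \<in> space M - N \<Longrightarrow>
      (\<forall>k n i. \<omega> \<in> A k n \<longrightarrow> (\<exists>h\<in>Gs k n. rdist (x i) h \<omega> < (1/2)^k / 2)) \<and>
      (\<forall>h\<in>K. \<forall>i m. rdist (x i) (x m) \<omega> \<le> rdist (x i) h \<omega> + rdist (x m) h \<omega>)"
    by (rule AE_E3) blast
  have [measurable]: "N \<in> sets M" using N by auto
  note [measurable] = measurable_rdist[OF xc xc]
  \<comment> \<open>\<open>random_indices\<close> demands strict increase at every point of the
    space, not just almost surely. Setting \<open>D\<close> to 0 on the null set \<open>N\<close>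
    lets the extraction succeed there too and keeps \<open>D\<close> measurable.\<close>
  define D where "D i m \<omega> = (if \<omega> \<in> N then 0 else rdist (x i) (x m) \<omega>)" for i m \<omega>
  have [measurable]: "D i m \<in> borel_measurable M" for i m unfolding D_def by measurable
  have close: "\<exists>i\<in>S. infinite {m\<in>S. i < m \<and> D i m \<omega> < (1/2)^k}"
    if \<omega>: "\<omega> \<in> space M" and S: "infinite S" for \<omega> k S
  proof (cases "\<omega> \<in> N")
    case True
    obtain i where i: "i \<in> S" using S by fastforce
    have "infinite (S - {..i})" using S by simp
    moreover have "S - {..i} = {m\<in>S. i < m \<and> D i m \<omega> < (1/2)^k}" using True by (auto simp: D_def)
    ultimately show ?thesis using i by metis
  next
    case False
    obtain n where n: "\<omega> \<in> A k n" using A[of k] \<omega> by (auto simp: countable_partition_def)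
    have "\<exists>i\<in>S. infinite {m\<in>S. i < m \<and> rdist (x i) (x m) \<omega> < (1/2)^k}"
      by (rule infinite_close_pairs[where D = "\<lambda>a b. rdist a b \<omega>" and K = "Gs k n"])
        (use good[of \<omega>] False \<omega> n Gs S in \<open>auto simp: K_def\<close>)
    then show ?thesis using False by (simp add: D_def)
  qed
  define n where "n = nested_index D"
  have n: "random_indices M n"
    unfolding n_def random_indices_def
  proof (intro conjI allI ballI)
    fix k \<omega> assume "\<omega> \<in> space M"
    then show "nested_index D k \<omega> < nested_index D (Suc k) \<omega>"
      by (intro nested_index_props(1) close)
  qed (rule measurable_nested_index, measurable)
  define y where "y = random_subseq M E x n"
  have yG: "y k \<in> G" and yx: "AE \<omega> in M. rdist (y k) (x (n k \<omega>)) \<omega> = 0" for k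
    using random_subseq_props[OF G x n, of k] by (auto simp: y_def)
  have yc: "y k \<in> carrier E" for k using yG Gc by blast
  have step: "AE \<omega> in M. rdist (y k) (y (Suc k)) \<omega> < (1/2)^k" for k
  proof -
    have "AE \<omega> in M. \<forall>a b. rdist (y k) (x a) \<omega> = 0 \<longrightarrow> rdist (y (Suc k)) (x b) \<omega> = 0 \<longrightarrow>
        rdist (y k) (y (Suc k)) \<omega> = rdist (x a) (x b) \<omega>"
      unfolding AE_all_countable by (intro allI AE_rdist_cong yc xc)
    with yx[of k] yx[of "Suc k"] AE_not_in[OF N] AE_space show ?thesis
    proof eventually_elim
      case (elim \<omega>)
      have "D (n k \<omega>) (n (Suc k) \<omega>) \<omega> < (1/2)^k"
        unfolding n_def by (intro nested_index_props(2) close elim(4))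
      then show ?case using elim by (simp add: D_def)
    qed
  qed
  have "el_Cauchy M E nrm y"
    unfolding el_Cauchy_iff[of y, OF yc]
  proof (intro allI impI)
    fix e :: real assume e: "e > 0"
    \<comment> \<open>Each tail point is within \<open>2 * (1/2)^j < e / 2\<close> of
      \<open>y j\<close>, and two tail points are compared through \<open>y j\<close>.\<close>
    obtain j :: nat where j: "(1/2)^j < e / 4"
      using real_arch_pow_inv[of "e/4" "1/2"] e by auto
    have "AE \<omega> in M. \<forall>k. rdist (y k) (y (Suc k)) \<omega> < (1/2)^k"
      unfolding AE_all_countable using step by blast
    with AE_rdist_pseudometric[of y, OF yc]
    have near: "AE \<omega> in M. \<forall>m\<ge>j. \<forall>l\<ge>j. rdist (y m) (y l) \<omega> < e"
    proof eventually_elim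
      case (elim \<omega>)
      have "rdist (y j) (y m) \<omega> < e / 2" if "m \<ge> j" for m
      proof -
        have "rdist (y j) (y m) \<omega> \<le> 2 * (1/2)^j - 2 * (1/2)^m"
          by (rule geometric_chain[where D = "\<lambda>a b. rdist (y a) (y b) \<omega>"]) (use elim that in auto)
        moreover have "0 < (1/2::real)^m" by simp
        ultimately show ?thesis using j by linarith
      qed
      moreover have "rdist (y m) (y l) \<omega> \<le> rdist (y j) (y m) \<omega> + rdist (y j) (y l) \<omega>" for m l
        using elim(1) by metis
      ultimately show ?case by (smt (verit) field_sum_of_halves)
    qed
    have "near e e (y m) (y l)" if "m \<ge> j" "l \<ge> j" for m l
    proof (rule near_AE)
      show "AE \<omega> in M. rdist (y m) (y l) \<omega> < e" using near by eventually_elim (use that in blast)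
    qed fact
    then show "\<exists>N. \<forall>m\<ge>N. \<forall>n\<ge>N. near e e (y m) (y n)" by blast
  qed
  then obtain g where "g \<in> G" "limitin (el_topology M E nrm) y g sequentially"
    using C yG unfolding el_complete_def by blast
  then show "\<exists>n. random_indices M n \<and>
      (\<exists>g\<in>G. limitin (el_topology M E nrm) (random_subseq M E x n) g sequentially)"
    using n unfolding y_def by blast
qed

end

theorem theorem2p3:
  fixes M :: "'w measure"
    and E :: "(('w \<Rightarrow> 'k::{real_normed_field, euclidean_space}) set, 'e, 'm) module_scheme"
    and nrm :: "'e \<Rightarrow> ('w \<Rightarrow> real) set"
    and G :: "'e set"
  assumes "rn_module M E nrm"
    and "sigma_stable M E G"
  shows "random_seq_compact M E nrm G \<longleftrightarrow>
    random_totally_bounded M E nrm G \<and> el_complete M E nrm G"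
proof -
  interpret rn_module M E nrm by fact
  show ?thesis
    using random_seq_compact_imp_random_totally_bounded random_seq_compact_imp_el_complete
      complete_random_totally_bounded_imp_random_seq_compact assms(2) by blast
qed

end
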